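(* For every elementary doctrine $P:\mathcal{C}^{op}\to\mathbf{InfSL}$, pre-composition with the 1-arrow $(K,k):P\to (P)_x$ of $\mathbf{ED}$ induces an essential equivalence of categories $$-\circ(K,k):\mathbf{CED}((P)_x,Z)\equiv\mathbf{ED}(P,Z)$$ for every $Z$ in $\mathbf{CED}$.
   Context: $\mathbf{InfSL}$ is the category of inf-semilattices (with top element $\top$) and homomorphisms. An elementary doctrine is a functor $P:\mathcal{C}^{op}\to\mathbf{InfSL}$, $\mathcal{C}$ a category with binary products (the action of $P$ on an arrow $f$ is written $P_f$), such that for every object $A$ of $\mathcal{C}$ there is $\delta_A\in P(A\times A)$ with: (i) $\alpha\mapsto P_{pr_1}(\alpha)\wedge\delta_A$, for $\alpha\in P(A)$, is left adjoint to $P_{\langle id_A,id_A\rangle}:P(A\times A)\to P(A)$; (ii) for every map $e=\langle pr_1,pr_2,pr_2\rangle:X\times A\to X\times A\times A$, the assignment $\alpha\mapsto P_{\langle pr_1,pr_2\rangle}(\alpha)\wedge P_{\langle pr_2,pr_3\rangle}(\delta_A)$, for $\alpha\in P(X\times A)$, is left adjoint to $P_e:P(X\times A\times A)\to P(X\times A)$. The 2-category $\mathbf{ED}$: objects are elementary doctrines. A 1-arrow from $P:\mathcal{C}^{op}\to\mathbf{InfSL}$ to $R:\mathcal{D}^{op}\to\mathbf{InfSL}$ is a pair $(F,b)$ with $F:\mathcal{C}\to\mathcal{D}$ a functor preserving binary products and $b:P\to R\circ F^{op}$ a natural transformation such that each $b_A:P(A)\to R(F(A))$ preserves finite meets and $b_{A\times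 A}(\delta_A)=R_{\langle F(pr_1),F(pr_2)\rangle}(\delta_{F(A)})$ for all $A$. A 2-arrow $(F,b)\Rightarrow(G,c)$ is a natural transformation $\theta:F\to G$ such that $b_A(\alpha)\le R_{\theta_A}(c_A(\alpha))$ for all $A$ and $\alpha\in P(A)$. A comprehension of $\alpha\in P(A)$ is a map $c:X\to A$ with $P_c(\alpha)=\top_X$ such that for every $f:Z\to A$ with $P_f(\alpha)=\top_Z$ there is a unique $g:Z\to X$ with $f=c\circ g$. An elementary doctrine $P$ has comprehensive diagonals if every diagonal $\langle id_A,id_A\rangle:A\to A\times A$ is a comprehension (of some object of $P(A\times A)$). $\mathbf{CED}$ is the full 2-subcategory of $\mathbf{ED}$ on the elementary doctrines with comprehensive diagonals. The extensional collapse $\mathcal{X}_P$ is the category whose objects are the objects of $\mathcal{C}$, and whose arrows $[f]:A\to B$ are equivalence classes of arrows $f:A\to B$ of $\mathcal{C}$ such that $\delta_A\le P_{f\times f}(\delta_B)$ in $P(A\times A)$, with respect to the equivalence relating $f$ and $f'$ when $\delta_A\le P_{f\times f'}(\delta_B)$; composition and identities are given on representatives by those of $\mathcal{C}$. The elementary doctrine $(P)_x:\mathcal{X}_P^{op}\to\mathbf{InfSL}$ is $(P)_x(A)=P(A)$ and $((P)_x)_{[f]}=P_f$. The 1-arrow $(K,k):P\to(P)_x$ consists of the quotient functor $K:\mathcal{C}\to\mathcal{X}_P$ (identity on objects, $f\mapsto[f]$) and $k_A$ the identity of $P(A)$. An essential equivalence of categories is a functor that is full, faithful and essentially surjective. 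*)

theory Defs
  imports "HOL-Library.FuncSet" "HOL-Algebra.Galois_Connection"
begin

section \<open>Categories with binary products\<close>

record ('o, 'a) category =
  Obj :: "'o set"
  Arr :: "'a set"
  Dom :: "'a \<Rightarrow> 'o"
  Cod :: "'a \<Rightarrow> 'o"
  Ide :: "'o \<Rightarrow> 'a"
  Comp :: "'a \<Rightarrow> 'a \<Rightarrow> 'a"  (infixr \<open>\<cdot>\<index>\<close> 75)

definition Hom :: "('o, 'a, 'm) category_scheme \<Rightarrow> 'o \<Rightarrow> 'o \<Rightarrow> 'a set" where
  "Hom C A B = {f \<in> Arr C. Dom C f = A \<and> Cod C f = B}"

locale category =
  fixes C :: "('o, 'a, 'm) category_scheme" (structure)
  assumes Dom_in_Obj: "f \<in> Arr C \<Longrightarrow> Dom C f \<in> Obj C"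
    and Cod_in_Obj: "f \<in> Arr C \<Longrightarrow> Cod C f \<in> Obj C"
    and Ide_in_Hom: "A \<in> Obj C \<Longrightarrow> Ide C A \<in> Hom C A A"
    and Comp_in_Hom: "\<lbrakk>f \<in> Hom C A B; g \<in> Hom C B D\<rbrakk> \<Longrightarrow> g \<cdot> f \<in> Hom C A D"
    and Comp_Ide: "f \<in> Hom C A B \<Longrightarrow> f \<cdot> Ide C A = f"
    and Ide_Comp: "f \<in> Hom C A B \<Longrightarrow> Ide C B \<cdot> f = f"
    and Comp_assoc:
      "\<lbrakk>f \<in> Hom C A B; g \<in> Hom C B D; h \<in> Hom C D E\<rbrakk> \<Longrightarrow> (h \<cdot> g) \<cdot> f = h \<cdot> (g \<cdot> f)"

definition isomorphic :: "('o, 'a, 'm) category_scheme \<Rightarrow> 'o \<Rightarrow> 'o \<Rightarrow> bool" where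
  "isomorphic C A B \<longleftrightarrow>
     (\<exists>f \<in> Hom C A B. \<exists>g \<in> Hom C B A. g \<cdot>\<^bsub>C\<^esub> f = Ide C A \<and> f \<cdot>\<^bsub>C\<^esub> g = Ide C B)"

definition is_product ::
    "('o, 'a, 'm) category_scheme \<Rightarrow> 'o \<Rightarrow> 'o \<Rightarrow> 'o \<Rightarrow> 'a \<Rightarrow> 'a \<Rightarrow> bool" where
  "is_product C A B X p q \<longleftrightarrow>
     p \<in> Hom C X A \<and> q \<in> Hom C X B \<and>
     (\<forall>Y. \<forall>f \<in> Hom C Y A. \<forall>g \<in> Hom C Y B.
        \<exists>!h. h \<in> Hom C Y X \<and> p \<cdot>\<^bsub>C\<^esub> h = f \<and> q \<cdot>\<^bsub>C\<^esub> h = g)"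

text \<open>Binary products are given by a choice of product diagrams.  Nothing below depends on
  the choice: functors only have to preserve products up to isomorphism.\<close>

record ('o, 'a) prod_category = "('o, 'a) category" +
  Prod :: "'o \<Rightarrow> 'o \<Rightarrow> 'o"
  Pr1 :: "'o \<Rightarrow> 'o \<Rightarrow> 'a"
  Pr2 :: "'o \<Rightarrow> 'o \<Rightarrow> 'a"

locale category_with_products = category C
  for C :: "('o, 'a, 'm) prod_category_scheme" (structure) +
  assumes is_product_Prod:
    "\<lbrakk>A \<in> Obj C; B \<in> Obj C\<rbrakk> \<Longrightarrow> is_product C A B (Prod C A B) (Pr1 C A B) (Pr2 C A B)"

definition pair :: "('o, 'a, 'm) prod_category_scheme \<Rightarrow> 'a \<Rightarrow> 'a \<Rightarrow> 'a" where
  "pair C f g =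
     (THE h. h \<in> Hom C (Dom C f) (Prod C (Cod C f) (Cod C g)) \<and>
        Pr1 C (Cod C f) (Cod C g) \<cdot>\<^bsub>C\<^esub> h = f \<and>
        Pr2 C (Cod C f) (Cod C g) \<cdot>\<^bsub>C\<^esub> h = g)"

definition prod_arr :: "('o, 'a, 'm) prod_category_scheme \<Rightarrow> 'a \<Rightarrow> 'a \<Rightarrow> 'a" where
  "prod_arr C f g =
     pair C (f \<cdot>\<^bsub>C\<^esub> Pr1 C (Dom C f) (Dom C g)) (g \<cdot>\<^bsub>C\<^esub> Pr2 C (Dom C f) (Dom C g))"

definition diag :: "('o, 'a, 'm) prod_category_scheme \<Rightarrow> 'o \<Rightarrow> 'a" where
  "diag C A = pair C (Ide C A) (Ide C A)"

text \<open>The ternary product \<open>A \<times> B \<times> D\<close> is read as \<open>(A \<times> B) \<times> D\<close>.\<close>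

definition Prod3 :: "('o, 'a, 'm) prod_category_scheme \<Rightarrow> 'o \<Rightarrow> 'o \<Rightarrow> 'o \<Rightarrow> 'o" where
  "Prod3 C A B D = Prod C (Prod C A B) D"

definition Pr3_1 :: "('o, 'a, 'm) prod_category_scheme \<Rightarrow> 'o \<Rightarrow> 'o \<Rightarrow> 'o \<Rightarrow> 'a" where
  "Pr3_1 C A B D = Pr1 C A B \<cdot>\<^bsub>C\<^esub> Pr1 C (Prod C A B) D"

definition Pr3_2 :: "('o, 'a, 'm) prod_category_scheme \<Rightarrow> 'o \<Rightarrow> 'o \<Rightarrow> 'o \<Rightarrow> 'a" where
  "Pr3_2 C A B D = Pr2 C A B \<cdot>\<^bsub>C\<^esub> Pr1 C (Prod C A B) D"

definition Pr3_3 :: "('o, 'a, 'm) prod_category_scheme \<Rightarrow> 'o \<Rightarrow> 'o \<Rightarrow> 'o \<Rightarrow> 'a" where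
  "Pr3_3 C A B D = Pr2 C (Prod C A B) D"

definition triple :: "('o, 'a, 'm) prod_category_scheme \<Rightarrow> 'a \<Rightarrow> 'a \<Rightarrow> 'a \<Rightarrow> 'a" where
  "triple C f g h = pair C (pair C f g) h"


section \<open>Functors and essential equivalences\<close>

text \<open>Maps are required to be extensional (\<open>undefined\<close> outside their domain), so that
  equality of functors, 1-arrows and 2-arrows is the mathematical one.\<close>

record ('o, 'a, 'o2, 'a2) cfunctor =
  Obj_map :: "'o \<Rightarrow> 'o2"
  Arr_map :: "'a \<Rightarrow> 'a2"

definition is_functor ::
    "('o, 'a, 'm) category_scheme \<Rightarrow> ('o2, 'a2, 'm2) category_scheme \<Rightarrow>
     ('o, 'a, 'o2, 'a2) cfunctor \<Rightarrow> bool" where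
  "is_functor C D F \<longleftrightarrow>
     category C \<and> category D \<and>
     Obj_map F \<in> Obj C \<rightarrow>\<^sub>E Obj D \<and> Arr_map F \<in> Arr C \<rightarrow>\<^sub>E Arr D \<and>
     (\<forall>A B. \<forall>f \<in> Hom C A B. Arr_map F f \<in> Hom D (Obj_map F A) (Obj_map F B)) \<and>
     (\<forall>A \<in> Obj C. Arr_map F (Ide C A) = Ide D (Obj_map F A)) \<and>
     (\<forall>A B E. \<forall>f \<in> Hom C A B. \<forall>g \<in> Hom C B E.
        Arr_map F (g \<cdot>\<^bsub>C\<^esub> f) = Arr_map F g \<cdot>\<^bsub>D\<^esub> Arr_map F f)"

definition comp_functor ::
    "('o, 'a, 'm) category_scheme \<Rightarrow> ('o2, 'a2, 'o3, 'a3) cfunctor \<Rightarrow>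
     ('o, 'a, 'o2, 'a2) cfunctor \<Rightarrow> ('o, 'a, 'o3, 'a3) cfunctor" where
  "comp_functor C G F =
     \<lparr>Obj_map = compose (Obj C) (Obj_map G) (Obj_map F),
      Arr_map = compose (Arr C) (Arr_map G) (Arr_map F)\<rparr>"

definition preserves_products ::
    "('o, 'a, 'm) prod_category_scheme \<Rightarrow> ('o2, 'a2, 'm2) category_scheme \<Rightarrow>
     ('o, 'a, 'o2, 'a2) cfunctor \<Rightarrow> bool" where
  "preserves_products C D F \<longleftrightarrow>
     (\<forall>A \<in> Obj C. \<forall>B \<in> Obj C.
        is_product D (Obj_map F A) (Obj_map F B) (Obj_map F (Prod C A B))
          (Arr_map F (Pr1 C A B)) (Arr_map F (Pr2 C A B)))"

definition natural_transformation ::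
    "('o, 'a, 'm) category_scheme \<Rightarrow> ('o2, 'a2, 'm2) category_scheme \<Rightarrow>
     ('o, 'a, 'o2, 'a2) cfunctor \<Rightarrow> ('o, 'a, 'o2, 'a2) cfunctor \<Rightarrow> ('o \<Rightarrow> 'a2) \<Rightarrow> bool" where
  "natural_transformation C D F G \<theta> \<longleftrightarrow>
     \<theta> \<in> (\<Pi>\<^sub>E A \<in> Obj C. Hom D (Obj_map F A) (Obj_map G A)) \<and>
     (\<forall>A B. \<forall>f \<in> Hom C A B. \<theta> B \<cdot>\<^bsub>D\<^esub> Arr_map F f = Arr_map G f \<cdot>\<^bsub>D\<^esub> \<theta> A)"

definition full ::
    "('o, 'a, 'm) category_scheme \<Rightarrow> ('o2, 'a2, 'm2) category_scheme \<Rightarrow>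
     ('o, 'a, 'o2, 'a2) cfunctor \<Rightarrow> bool" where
  "full C D F \<longleftrightarrow>
     (\<forall>A \<in> Obj C. \<forall>B \<in> Obj C. \<forall>g \<in> Hom D (Obj_map F A) (Obj_map F B).
        \<exists>f \<in> Hom C A B. Arr_map F f = g)"

definition faithful ::
    "('o, 'a, 'm) category_scheme \<Rightarrow> ('o, 'a, 'o2, 'a2) cfunctor \<Rightarrow> bool" where
  "faithful C F \<longleftrightarrow> (\<forall>A \<in> Obj C. \<forall>B \<in> Obj C. inj_on (Arr_map F) (Hom C A B))"

definition essentially_surjective ::
    "('o, 'a, 'm) category_scheme \<Rightarrow> ('o2, 'a2, 'm2) category_scheme \<Rightarrow>
     ('o, 'a, 'o2, 'a2) cfunctor \<Rightarrow> bool" where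
  "essentially_surjective C D F \<longleftrightarrow>
     (\<forall>B \<in> Obj D. \<exists>A \<in> Obj C. isomorphic D (Obj_map F A) B)"

definition essential_equivalence ::
    "('o, 'a, 'm) category_scheme \<Rightarrow> ('o2, 'a2, 'm2) category_scheme \<Rightarrow>
     ('o, 'a, 'o2, 'a2) cfunctor \<Rightarrow> bool" where
  "essential_equivalence C D F \<longleftrightarrow>
     is_functor C D F \<and> full C D F \<and> faithful C F \<and> essentially_surjective C D F"


section \<open>Elementary doctrines\<close>

locale inf_semilattice = lower_semilattice L + weak_partial_order_top L for L (structure)

definition inf_semilattice_hom ::
    "('p, 'm) gorder_scheme \<Rightarrow> ('q, 'n) gorder_scheme \<Rightarrow> ('p \<Rightarrow> 'q) \<Rightarrow> bool" where
  "inf_semilattice_hom L M h \<longleftrightarrow>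
     h \<in> carrier L \<rightarrow> carrier M \<and>
     (\<forall>x \<in> carrier L. \<forall>y \<in> carrier L. h (x \<sqinter>\<^bsub>L\<^esub> y) = h x \<sqinter>\<^bsub>M\<^esub> h y) \<and>
     h \<top>\<^bsub>L\<^esub> = \<top>\<^bsub>M\<^esub>"

text \<open>\<open>Fib P A\<close> is the semilattice \<open>P(A)\<close> and \<open>Pull P f\<close> is \<open>P\<^sub>f\<close>.\<close>

record ('o, 'a, 'p) doctrine =
  Base :: "('o, 'a) prod_category"
  Fib :: "'o \<Rightarrow> 'p gorder"
  Pull :: "'a \<Rightarrow> 'p \<Rightarrow> 'p"

locale inf_semilattice_doctrine =
  fixes P :: "('o, 'a, 'p) doctrine"
  assumes Base_products: "category_with_products (Base P)"
    and Fib_semilattice: "A \<in> Obj (Base P) \<Longrightarrow> inf_semilattice (Fib P A)"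
    and Pull_hom:
      "f \<in> Hom (Base P) A B \<Longrightarrow> inf_semilattice_hom (Fib P B) (Fib P A) (Pull P f)"
    and Pull_Ide:
      "\<lbrakk>A \<in> Obj (Base P); \<alpha> \<in> carrier (Fib P A)\<rbrakk> \<Longrightarrow> Pull P (Ide (Base P) A) \<alpha> = \<alpha>"
    and Pull_Comp:
      "\<lbrakk>f \<in> Hom (Base P) A B; g \<in> Hom (Base P) B D; \<alpha> \<in> carrier (Fib P D)\<rbrakk>
        \<Longrightarrow> Pull P (g \<cdot>\<^bsub>Base P\<^esub> f) \<alpha> = Pull P f (Pull P g \<alpha>)"

definition fibred_equality :: "('o, 'a, 'p) doctrine \<Rightarrow> 'o \<Rightarrow> 'p \<Rightarrow> bool" where
  "fibred_equality P A d \<longleftrightarrow>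
     (let C = Base P in
      d \<in> carrier (Fib P (Prod C A A)) \<and>
      galois_connection
        \<lparr>orderA = Fib P A,
         orderB = Fib P (Prod C A A),
         lower = (\<lambda>\<alpha>. Pull P (Pr1 C A A) \<alpha> \<sqinter>\<^bsub>Fib P (Prod C A A)\<^esub> d),
         upper = Pull P (diag C A)\<rparr> \<and>
      (\<forall>X \<in> Obj C.
        galois_connection
          \<lparr>orderA = Fib P (Prod C X A),
           orderB = Fib P (Prod3 C X A A),
           lower = (\<lambda>\<alpha>.
             Pull P (pair C (Pr3_1 C X A A) (Pr3_2 C X A A)) \<alpha>
               \<sqinter>\<^bsub>Fib P (Prod3 C X A A)\<^esub>
             Pull P (pair C (Pr3_2 C X A A) (Pr3_3 C X A A)) d),
           upper = Pull P (triple C (Pr1 C X A) (Pr2 C X A) (Pr2 C X A))\<rparr>))"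

locale elementary_doctrine = inf_semilattice_doctrine +
  assumes fibred_equality_exists: "A \<in> Obj (Base P) \<Longrightarrow> \<exists>d. fibred_equality P A d"

text \<open>\<open>\<delta>\<^sub>A\<close>; it is unique, being the value at \<open>\<top>\<close> of a left adjoint.\<close>

definition delta :: "('o, 'a, 'p) doctrine \<Rightarrow> 'o \<Rightarrow> 'p" where
  "delta P A = (THE d. fibred_equality P A d)"

definition is_comprehension ::
    "('o, 'a, 'p) doctrine \<Rightarrow> 'o \<Rightarrow> 'p \<Rightarrow> 'o \<Rightarrow> 'a \<Rightarrow> bool" where
  "is_comprehension P A \<alpha> X c \<longleftrightarrow>
     c \<in> Hom (Base P) X A \<and> Pull P c \<alpha> = \<top>\<^bsub>Fib P X\<^esub> \<and>
     (\<forall>Z. \<forall>f \<in> Hom (Base P) Z A. Pull P f \<alpha> = \<top>\<^bsub>Fib P Z\<^esub> \<longrightarrow>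
        (\<exists>!g. g \<in> Hom (Base P) Z X \<and> f = c \<cdot>\<^bsub>Base P\<^esub> g))"

definition comprehensive_diagonals :: "('o, 'a, 'p) doctrine \<Rightarrow> bool" where
  "comprehensive_diagonals P \<longleftrightarrow>
     (\<forall>A \<in> Obj (Base P). \<exists>\<alpha> \<in> carrier (Fib P (Prod (Base P) A A)).
        is_comprehension P (Prod (Base P) A A) \<alpha> A (diag (Base P) A))"


section \<open>The 2-categories of elementary doctrines\<close>

text \<open>Doctrines over different types cannot be collected in one HOL set, so the 2-categories
  are given through their objects (\<open>elementary_doctrine\<close> and \<open>CED\<close>), their hom-categories
  (\<open>ED_hom\<close> and \<open>CED_hom\<close>) and composition with 1-arrows.\<close>

type_synonym ('o, 'a, 'p, 'o2, 'a2, 'p2) one_arrow =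
  "('o, 'a, 'o2, 'a2) cfunctor \<times> ('o \<Rightarrow> 'p \<Rightarrow> 'p2)"

definition is_one_arrow ::
    "('o, 'a, 'p) doctrine \<Rightarrow> ('o2, 'a2, 'p2) doctrine \<Rightarrow>
     ('o, 'a, 'p, 'o2, 'a2, 'p2) one_arrow \<Rightarrow> bool" where
  "is_one_arrow P R = (\<lambda>(F, b).
     is_functor (Base P) (Base R) F \<and>
     preserves_products (Base P) (Base R) F \<and>
     b \<in> (\<Pi>\<^sub>E A \<in> Obj (Base P). carrier (Fib P A) \<rightarrow>\<^sub>E carrier (Fib R (Obj_map F A))) \<and>
     (\<forall>A B. \<forall>f \<in> Hom (Base P) A B. \<forall>\<alpha> \<in> carrier (Fib P B).
        b A (Pull P f \<alpha>) = Pull R (Arr_map F f) (b B \<alpha>)) \<and>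
     (\<forall>A \<in> Obj (Base P).
        inf_semilattice_hom (Fib P A) (Fib R (Obj_map F A)) (b A) \<and>
        b (Prod (Base P) A A) (delta P A) =
          Pull R
            (pair (Base R) (Arr_map F (Pr1 (Base P) A A)) (Arr_map F (Pr2 (Base P) A A)))
            (delta R (Obj_map F A))))"

definition comp_one_arrow ::
    "('o, 'a, 'p) doctrine \<Rightarrow> ('o2, 'a2, 'p2, 'o3, 'a3, 'p3) one_arrow \<Rightarrow>
     ('o, 'a, 'p, 'o2, 'a2, 'p2) one_arrow \<Rightarrow> ('o, 'a, 'p, 'o3, 'a3, 'p3) one_arrow" where
  "comp_one_arrow P = (\<lambda>(G, c) (F, b).
     (comp_functor (Base P) G F,
      \<lambda>A \<in> Obj (Base P). compose (carrier (Fib P A)) (c (Obj_map F A)) (b A)))"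

record ('m, 'o, 'a) two_arrow =
  Src :: 'm
  Tgt :: 'm
  Cpt :: "'o \<Rightarrow> 'a"

definition is_two_arrow ::
    "('o, 'a, 'p) doctrine \<Rightarrow> ('o2, 'a2, 'p2) doctrine \<Rightarrow>
     (('o, 'a, 'p, 'o2, 'a2, 'p2) one_arrow, 'o, 'a2) two_arrow \<Rightarrow> bool" where
  "is_two_arrow P R \<theta> \<longleftrightarrow>
     is_one_arrow P R (Src \<theta>) \<and> is_one_arrow P R (Tgt \<theta>) \<and>
     natural_transformation (Base P) (Base R) (fst (Src \<theta>)) (fst (Tgt \<theta>)) (Cpt \<theta>) \<and>
     (\<forall>A \<in> Obj (Base P). \<forall>\<alpha> \<in> carrier (Fib P A).
        snd (Src \<theta>) A \<alpha> \<sqsubseteq>\<^bsub>Fib R (Obj_map (fst (Src \<theta>)) A)\<^esub>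
          Pull R (Cpt \<theta> A) (snd (Tgt \<theta>) A \<alpha>))"

definition ED_hom ::
    "('o, 'a, 'p) doctrine \<Rightarrow> ('o2, 'a2, 'p2) doctrine \<Rightarrow>
     (('o, 'a, 'p, 'o2, 'a2, 'p2) one_arrow,
      (('o, 'a, 'p, 'o2, 'a2, 'p2) one_arrow, 'o, 'a2) two_arrow) category" where
  "ED_hom P R =
     \<lparr>Obj = {m. is_one_arrow P R m},
      Arr = {\<theta>. is_two_arrow P R \<theta>},
      Dom = Src,
      Cod = Tgt,
      Ide = (\<lambda>m. \<lparr>Src = m, Tgt = m,
        Cpt = (\<lambda>A \<in> Obj (Base P). Ide (Base R) (Obj_map (fst m) A))\<rparr>),
      Comp = (\<lambda>\<eta> \<theta>. \<lparr>Src = Src \<theta>, Tgt = Tgt \<eta>,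
        Cpt = (\<lambda>A \<in> Obj (Base P). Cpt \<eta> A \<cdot>\<^bsub>Base R\<^esub> Cpt \<theta> A)\<rparr>)\<rparr>"

definition CED :: "('o, 'a, 'p) doctrine \<Rightarrow> bool" where
  "CED P \<longleftrightarrow> elementary_doctrine P \<and> comprehensive_diagonals P"

text \<open>\<open>CED\<close> is a full 2-subcategory, so between doctrines satisfying \<open>CED\<close> the
  hom-category is that of \<open>ED\<close>.\<close>

definition CED_hom ::
    "('o, 'a, 'p) doctrine \<Rightarrow> ('o2, 'a2, 'p2) doctrine \<Rightarrow>
     (('o, 'a, 'p, 'o2, 'a2, 'p2) one_arrow,
      (('o, 'a, 'p, 'o2, 'a2, 'p2) one_arrow, 'o, 'a2) two_arrow) category" where
  "CED_hom P R = ED_hom P R"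

text \<open>The functor \<open>- \<circ> m\<close>, for a 1-arrow \<open>m\<close> out of \<open>P\<close>, defined on a hom-category \<open>H\<close> of
  1-arrows out of the target of \<open>m\<close>; on 2-arrows it is whiskering with \<open>m\<close>.\<close>

definition precomp ::
    "('o, 'a, 'p) doctrine \<Rightarrow> ('o, 'a, 'p, 'o2, 'a2, 'p2) one_arrow \<Rightarrow>
     (('o2, 'a2, 'p2, 'o3, 'a3, 'p3) one_arrow,
      (('o2, 'a2, 'p2, 'o3, 'a3, 'p3) one_arrow, 'o2, 'a3) two_arrow) category \<Rightarrow>
     (('o2, 'a2, 'p2, 'o3, 'a3, 'p3) one_arrow,
      (('o2, 'a2, 'p2, 'o3, 'a3, 'p3) one_arrow, 'o2, 'a3) two_arrow,
      ('o, 'a, 'p, 'o3, 'a3, 'p3) one_arrow,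
      (('o, 'a, 'p, 'o3, 'a3, 'p3) one_arrow, 'o, 'a3) two_arrow) cfunctor" where
  "precomp P m H =
     \<lparr>Obj_map = (\<lambda>n \<in> Obj H. comp_one_arrow P n m),
      Arr_map = (\<lambda>\<theta> \<in> Arr H.
        \<lparr>Src = comp_one_arrow P (Src \<theta>) m,
         Tgt = comp_one_arrow P (Tgt \<theta>) m,
         Cpt = compose (Obj (Base P)) (Cpt \<theta>) (Obj_map (fst m))\<rparr>)\<rparr>"


section \<open>The extensional collapse\<close>

definition ext_arrows :: "('o, 'a, 'p) doctrine \<Rightarrow> 'o \<Rightarrow> 'o \<Rightarrow> 'a set" where
  "ext_arrows P A B =
     {f \<in> Hom (Base P) A B.
        delta P A \<sqsubseteq>\<^bsub>Fib P (Prod (Base P) A A)\<^esub> Pull P (prod_arr (Base P) f f) (delta P B)}"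

definition ext_rel :: "('o, 'a, 'p) doctrine \<Rightarrow> 'o \<Rightarrow> 'o \<Rightarrow> ('a \<times> 'a) set" where
  "ext_rel P A B =
     {(f, f'). f \<in> ext_arrows P A B \<and> f' \<in> ext_arrows P A B \<and>
        delta P A \<sqsubseteq>\<^bsub>Fib P (Prod (Base P) A A)\<^esub> Pull P (prod_arr (Base P) f f') (delta P B)}"

definition ext_class :: "('o, 'a, 'p) doctrine \<Rightarrow> 'a \<Rightarrow> 'a set" where
  "ext_class P f = ext_rel P (Dom (Base P) f) (Cod (Base P) f) `` {f}"

definition rep :: "'a set \<Rightarrow> 'a" where
  "rep \<phi> = (SOME f. f \<in> \<phi>)"

definition ext_category :: "('o, 'a, 'p) doctrine \<Rightarrow> ('o, 'a set) prod_category" where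
  "ext_category P =
     \<lparr>Obj = Obj (Base P),
      Arr = (\<Union>A \<in> Obj (Base P). \<Union>B \<in> Obj (Base P). ext_arrows P A B // ext_rel P A B),
      Dom = (\<lambda>\<phi>. Dom (Base P) (rep \<phi>)),
      Cod = (\<lambda>\<phi>. Cod (Base P) (rep \<phi>)),
      Ide = (\<lambda>A. ext_class P (Ide (Base P) A)),
      Comp = (\<lambda>\<psi> \<phi>. ext_class P (rep \<psi> \<cdot>\<^bsub>Base P\<^esub> rep \<phi>)),
      Prod = Prod (Base P),
      Pr1 = (\<lambda>A B. ext_class P (Pr1 (Base P) A B)),
      Pr2 = (\<lambda>A B. ext_class P (Pr2 (Base P) A B))\<rparr>"

definition ext_collapse :: "('o, 'a, 'p) doctrine \<Rightarrow> ('o, 'a set, 'p) doctrine" where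
  "ext_collapse P =
     \<lparr>Base = ext_category P, Fib = Fib P, Pull = (\<lambda>\<phi>. Pull P (rep \<phi>))\<rparr>"

text \<open>The 1-arrow \<open>(K, k)\<close> from \<open>P\<close> to its collapse.\<close>

definition collapse_arrow ::
    "('o, 'a, 'p) doctrine \<Rightarrow> ('o, 'a, 'p, 'o, 'a set, 'p) one_arrow" where
  "collapse_arrow P =
     (\<lparr>Obj_map = (\<lambda>A \<in> Obj (Base P). A),
       Arr_map = (\<lambda>f \<in> Arr (Base P). ext_class P f)\<rparr>,
      \<lambda>A \<in> Obj (Base P). \<lambda>\<alpha> \<in> carrier (Fib P A). \<alpha>)"

end

theory Submission
  imports Defs
begin

text \<open>
  Everything rests on reading \<open>P\<^bsub>\<langle>f,g\<rangle>\<^esub>(\<delta>\<^sub>A)\<close> as the predicate \<open>f(y) = g(y)\<close>, for two arrows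
  \<open>f, g : Y \<rightarrow> A\<close>. Call \<open>f\<close> and \<open>g\<close> internally equal if this predicate is \<open>\<top>\<close>. The two adjunctions
  defining an elementary doctrine say that \<open>\<delta>\<^sub>A\<close> is the least reflexive predicate
  (\<open>delta_le_iff\<close>) and that internally equal arrows can be substituted for each other in any
  predicate (\<open>Pull_pair_le\<close>). Substitution makes internal equality an equivalence relation that
  is stable under composition and pairing. Leastness of \<open>\<delta>\<^sub>A\<close> shows that every arrow is
  extensional, and that the relation defining the collapse is internal equality
  (\<open>delta_le_prod_arr_iff\<close>). So the collapse is the quotient of the base by internal equality, with
  the same objects, product diagrams, fibres and fibred equalities. In it internally equal
  arrows are equal, which is the reason why its diagonals are comprehensions.

  Conversely, in a doctrine \<open>Z\<close> with comprehensive diagonals internally equal arrows are equal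
  (\<open>internally_equal_imp_eq\<close>), and 1-arrows preserve internal equality because they preserve
  \<open>\<delta>\<close> (\<open>one_arrow_internally_equal\<close>). A 1-arrow from \<open>P\<close> to \<open>Z\<close> thus takes equal values on equivalent
  arrows, and factors through the collapse
  (\<open>one_arrow_factors_through_collapse\<close>), so precomposition is surjective on objects. Since \<open>K\<close> is
  the identity on objects and full, a family of components is a 2-arrow between 1-arrows out
  of the collapse exactly when it is one between their composites with \<open>(K, k)\<close>
  (\<open>is_two_arrow_along_quotient_iff\<close>). Precomposition does not change the components, so it is full
  and faithful.
\<close>


section \<open>Pairing in a category with binary products\<close>

lemma HomI: "f \<in> Arr C \<Longrightarrow> f \<in> Hom C (Dom C f) (Cod C f)"
  by (simp add: Hom_def)

lemma Hom_Dom: "f \<in> Hom C A B \<Longrightarrow> Dom C f = A"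
  and Hom_Cod: "f \<in> Hom C A B \<Longrightarrow> Cod C f = B"
  and Hom_Arr: "f \<in> Hom C A B \<Longrightarrow> f \<in> Arr C"
  by (simp_all add: Hom_def)

lemma (in category) Hom_Obj:
  assumes "f \<in> Hom C A B"
  shows "A \<in> Obj C" "B \<in> Obj C"
  using assms Dom_in_Obj Cod_in_Obj by (auto simp: Hom_def)

context category_with_products
begin

lemma Pr_in_Hom:
  assumes "A \<in> Obj C" "B \<in> Obj C"
  shows "Pr1 C A B \<in> Hom C (Prod C A B) A" "Pr2 C A B \<in> Hom C (Prod C A B) B"
  using is_product_Prod[OF assms] by (simp_all add: is_product_def)

lemma Prod_in_Obj: "A \<in> Obj C \<Longrightarrow> B \<in> Obj C \<Longrightarrow> Prod C A B \<in> Obj C"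
  using Pr_in_Hom(1) Hom_Obj(1) by blast

lemma pair_properties:
  assumes f: "f \<in> Hom C Y A" and g: "g \<in> Hom C Y B"
  shows pair_in_Hom: "pair C f g \<in> Hom C Y (Prod C A B)"
    and Pr1_pair: "Pr1 C A B \<cdot> pair C f g = f"
    and Pr2_pair: "Pr2 C A B \<cdot> pair C f g = g"
proof -
  have "\<exists>!h. h \<in> Hom C Y (Prod C A B) \<and> Pr1 C A B \<cdot> h = f \<and> Pr2 C A B \<cdot> h = g"
    using is_product_Prod[OF Hom_Obj(2)[OF f] Hom_Obj(2)[OF g]] f g
    by (simp add: is_product_def)
  from theI'[OF this]
  show "pair C f g \<in> Hom C Y (Prod C A B)" "Pr1 C A B \<cdot> pair C f g = f"
    "Pr2 C A B \<cdot> pair C f g = g"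
    by (simp_all add: pair_def Hom_Dom[OF f] Hom_Cod[OF f] Hom_Cod[OF g])
qed

lemma Prod_arrow_eqI:
  assumes h: "h \<in> Hom C Y (Prod C A B)" and k: "k \<in> Hom C Y (Prod C A B)"
    and obj: "A \<in> Obj C" "B \<in> Obj C"
    and eq: "Pr1 C A B \<cdot> h = Pr1 C A B \<cdot> k" "Pr2 C A B \<cdot> h = Pr2 C A B \<cdot> k"
  shows "h = k"
proof -
  have "Pr1 C A B \<cdot> k \<in> Hom C Y A" "Pr2 C A B \<cdot> k \<in> Hom C Y B"
    using Comp_in_Hom[OF k] Pr_in_Hom[OF obj] by blast+
  then have "\<exists>!l. l \<in> Hom C Y (Prod C A B) \<and> Pr1 C A B \<cdot> l = Pr1 C A B \<cdot> k
      \<and> Pr2 C A B \<cdot> l = Pr2 C A B \<cdot> k"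
    using is_product_Prod[OF obj] by (simp add: is_product_def)
  then show ?thesis
    using h k eq by blast
qed

lemma pair_eqI:
  assumes h: "h \<in> Hom C Y (Prod C A B)" and obj: "A \<in> Obj C" "B \<in> Obj C"
    and eq: "Pr1 C A B \<cdot> h = f" "Pr2 C A B \<cdot> h = g"
  shows "pair C f g = h"
proof -
  have f: "f \<in> Hom C Y A" and g: "g \<in> Hom C Y B"
    using Comp_in_Hom[OF h] Pr_in_Hom[OF obj] eq by blast+
  show ?thesis
    by (rule Prod_arrow_eqI[OF pair_in_Hom[OF f g] h obj])
      (simp_all add: Pr1_pair[OF f g] Pr2_pair[OF f g] eq)
qed

lemma pair_Comp:
  assumes f: "f \<in> Hom C Y A" and g: "g \<in> Hom C Y B" and h: "h \<in> Hom C W Y"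
  shows "pair C f g \<cdot> h = pair C (f \<cdot> h) (g \<cdot> h)"
proof -
  note fg = pair_in_Hom[OF f g] and obj = Hom_Obj(2)[OF f] Hom_Obj(2)[OF g]
  show ?thesis
    by (rule pair_eqI[OF Comp_in_Hom[OF h fg] obj, symmetric])
      (simp_all add: Comp_assoc[OF h fg Pr_in_Hom(1)[OF obj], symmetric]
        Comp_assoc[OF h fg Pr_in_Hom(2)[OF obj], symmetric] Pr1_pair[OF f g] Pr2_pair[OF f g])
qed

lemma pair_eta:
  assumes h: "h \<in> Hom C Y (Prod C A B)" and obj: "A \<in> Obj C" "B \<in> Obj C"
  shows "pair C (Pr1 C A B \<cdot> h) (Pr2 C A B \<cdot> h) = h"
  by (rule pair_eqI[OF h obj refl refl])

lemma diag_in_Hom: "A \<in> Obj C \<Longrightarrow> diag C A \<in> Hom C A (Prod C A A)"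
  unfolding diag_def by (intro pair_in_Hom Ide_in_Hom)

lemma diag_Comp: "f \<in> Hom C Y A \<Longrightarrow> diag C A \<cdot> f = pair C f f"
  unfolding diag_def
  using pair_Comp[OF Ide_in_Hom Ide_in_Hom] Ide_Comp Hom_Obj(2) by metis

lemma prod_arr_in_Hom:
  assumes f: "f \<in> Hom C A A'" and g: "g \<in> Hom C B B'"
  shows "prod_arr C f g \<in> Hom C (Prod C A B) (Prod C A' B')"
  unfolding prod_arr_def Hom_Dom[OF f] Hom_Dom[OF g]
  by (intro pair_in_Hom Comp_in_Hom[OF _ f] Comp_in_Hom[OF _ g] Pr_in_Hom Hom_Obj(1)[OF f]
      Hom_Obj(1)[OF g])

lemma prod_arr_pair:
  assumes f: "f \<in> Hom C A A'" and g: "g \<in> Hom C B B'"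
    and h: "h \<in> Hom C Y A" and k: "k \<in> Hom C Y B"
  shows "prod_arr C f g \<cdot> pair C h k = pair C (f \<cdot> h) (g \<cdot> k)"
proof -
  note p = Pr_in_Hom(1)[OF Hom_Obj(1)[OF f] Hom_Obj(1)[OF g]]
    and q = Pr_in_Hom(2)[OF Hom_Obj(1)[OF f] Hom_Obj(1)[OF g]]
    and hk = pair_in_Hom[OF h k]
  show ?thesis
    unfolding prod_arr_def Hom_Dom[OF f] Hom_Dom[OF g]
    by (simp add: pair_Comp[OF Comp_in_Hom[OF p f] Comp_in_Hom[OF q g] hk]
        Comp_assoc[OF hk p f] Comp_assoc[OF hk q g] Pr1_pair[OF h k] Pr2_pair[OF h k])
qed

end

section \<open>Order and reindexing in the fibres\<close>

context inf_semilattice_doctrine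
begin

sublocale base: category_with_products "Base P"
  by (rule Base_products)

abbreviation fib_le :: "'o \<Rightarrow> 'p \<Rightarrow> 'p \<Rightarrow> bool" where
  "fib_le A \<equiv> le (Fib P A)"

lemma fib_order: "A \<in> Obj (Base P) \<Longrightarrow> partial_order (Fib P A)"
  using Fib_semilattice by (simp add: inf_semilattice_def lower_semilattice_def)

lemma fib_refl:
  assumes "A \<in> Obj (Base P)" "\<alpha> \<in> carrier (Fib P A)"
  shows "fib_le A \<alpha> \<alpha>"
proof -
  interpret inf_semilattice "Fib P A" by (rule Fib_semilattice[OF assms(1)])
  show ?thesis using assms(2) by (rule le_refl)
qed

lemma fib_trans:
  assumes "A \<in> Obj (Base P)" "fib_le A \<alpha> \<beta>" "fib_le A \<beta> \<gamma>" "\<alpha> \<in> carrier (Fib P A)"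
    "\<beta> \<in> carrier (Fib P A)" "\<gamma> \<in> carrier (Fib P A)"
  shows "fib_le A \<alpha> \<gamma>"
proof -
  interpret inf_semilattice "Fib P A" by (rule Fib_semilattice[OF assms(1)])
  show ?thesis using assms(2-) by (rule le_trans)
qed

lemma fib_antisym:
  assumes "A \<in> Obj (Base P)" "fib_le A \<alpha> \<beta>" "fib_le A \<beta> \<alpha>" "\<alpha> \<in> carrier (Fib P A)"
    "\<beta> \<in> carrier (Fib P A)"
  shows "\<alpha> = \<beta>"
proof -
  interpret inf_semilattice "Fib P A" by (rule Fib_semilattice[OF assms(1)])
  show ?thesis using assms(2-) by (rule le_antisym)
qed

lemma top_closed: "A \<in> Obj (Base P) \<Longrightarrow> \<top>\<^bsub>Fib P A\<^esub> \<in> carrier (Fib P A)"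
  and le_top: "A \<in> Obj (Base P) \<Longrightarrow> \<alpha> \<in> carrier (Fib P A) \<Longrightarrow> fib_le A \<alpha> \<top>\<^bsub>Fib P A\<^esub>"
proof -
  assume "A \<in> Obj (Base P)"
  then interpret inf_semilattice "Fib P A" by (rule Fib_semilattice)
  show "\<top>\<^bsub>Fib P A\<^esub> \<in> carrier (Fib P A)" by (rule top_closed)
  show "fib_le A \<alpha> \<top>\<^bsub>Fib P A\<^esub>" if "\<alpha> \<in> carrier (Fib P A)" using that by (rule top_higher)
qed

lemma top_le_iff:
  "A \<in> Obj (Base P) \<Longrightarrow> \<alpha> \<in> carrier (Fib P A) \<Longrightarrow>
    fib_le A \<top>\<^bsub>Fib P A\<^esub> \<alpha> \<longleftrightarrow> \<alpha> = \<top>\<^bsub>Fib P A\<^esub>"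
  using fib_antisym[OF _ le_top] top_closed fib_refl by metis

lemma meet_closed:
  assumes "A \<in> Obj (Base P)" "\<alpha> \<in> carrier (Fib P A)" "\<beta> \<in> carrier (Fib P A)"
  shows "\<alpha> \<sqinter>\<^bsub>Fib P A\<^esub> \<beta> \<in> carrier (Fib P A)"
proof -
  interpret inf_semilattice "Fib P A" by (rule Fib_semilattice[OF assms(1)])
  show ?thesis using assms(2-) by (rule meet_closed)
qed

lemma le_meet_iff:
  assumes "A \<in> Obj (Base P)" "\<alpha> \<in> carrier (Fib P A)" "\<beta> \<in> carrier (Fib P A)"
    "\<gamma> \<in> carrier (Fib P A)"
  shows "fib_le A \<gamma> (\<alpha> \<sqinter>\<^bsub>Fib P A\<^esub> \<beta>) \<longleftrightarrow> fib_le A \<gamma> \<alpha> \<and> fib_le A \<gamma> \<beta>"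
proof -
  interpret inf_semilattice "Fib P A" by (rule Fib_semilattice[OF assms(1)])
  show ?thesis
    using meet_le[OF _ _ assms(2-)] le_trans[OF _ meet_left[OF assms(2,3)]]
      le_trans[OF _ meet_right[OF assms(2,3)]] meet_closed[OF assms(2,3)] assms(2-) by blast
qed

lemma meet_eq_left:
  assumes "A \<in> Obj (Base P)" "\<alpha> \<in> carrier (Fib P A)" "\<beta> \<in> carrier (Fib P A)"
    and "fib_le A \<alpha> \<beta>"
  shows "\<alpha> \<sqinter>\<^bsub>Fib P A\<^esub> \<beta> = \<alpha>"
proof -
  interpret inf_semilattice "Fib P A" by (rule Fib_semilattice[OF assms(1)])
  show ?thesis
    by (rule le_antisym[OF meet_left[OF assms(2,3)]])
      (use assms(2-) in \<open>simp_all add: meet_le\<close>)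
qed

lemma top_meet:
  assumes "A \<in> Obj (Base P)" "\<alpha> \<in> carrier (Fib P A)"
  shows "\<top>\<^bsub>Fib P A\<^esub> \<sqinter>\<^bsub>Fib P A\<^esub> \<alpha> = \<alpha>"
proof -
  interpret inf_semilattice "Fib P A" by (rule Fib_semilattice[OF assms(1)])
  show ?thesis
    by (rule le_antisym[OF meet_right[OF top_closed assms(2)]])
      (use assms(2) in \<open>simp_all add: meet_le\<close>)
qed

lemma Pull_closed:
  "f \<in> Hom (Base P) A B \<Longrightarrow> \<beta> \<in> carrier (Fib P B) \<Longrightarrow> Pull P f \<beta> \<in> carrier (Fib P A)"
  using Pull_hom unfolding inf_semilattice_hom_def by blast

lemma Pull_top: "f \<in> Hom (Base P) A B \<Longrightarrow> Pull P f \<top>\<^bsub>Fib P B\<^esub> = \<top>\<^bsub>Fib P A\<^esub>"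
  using Pull_hom by (auto simp: inf_semilattice_hom_def)

lemma Pull_meet:
  "\<lbrakk>f \<in> Hom (Base P) A B; \<alpha> \<in> carrier (Fib P B); \<beta> \<in> carrier (Fib P B)\<rbrakk>
    \<Longrightarrow> Pull P f (\<alpha> \<sqinter>\<^bsub>Fib P B\<^esub> \<beta>) = Pull P f \<alpha> \<sqinter>\<^bsub>Fib P A\<^esub> Pull P f \<beta>"
  using Pull_hom by (auto simp: inf_semilattice_hom_def)

lemma Pull_mono:
  assumes f: "f \<in> Hom (Base P) A B"
    and ab: "\<alpha> \<in> carrier (Fib P B)" "\<beta> \<in> carrier (Fib P B)" "fib_le B \<alpha> \<beta>"
  shows "fib_le A (Pull P f \<alpha>) (Pull P f \<beta>)"
proof -
  note obj = base.Hom_Obj[OF f]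
  have "Pull P f \<alpha> = Pull P f \<alpha> \<sqinter>\<^bsub>Fib P A\<^esub> Pull P f \<beta>"
    using Pull_meet[OF f ab(1,2)] meet_eq_left[OF obj(2) ab] by simp
  then show ?thesis
    using le_meet_iff[OF obj(1) Pull_closed[OF f ab(1)] Pull_closed[OF f ab(2)]
        Pull_closed[OF f ab(1)]] fib_refl[OF obj(1) Pull_closed[OF f ab(1)]] by simp
qed

lemma Pr3_in_Hom:
  assumes "X \<in> Obj (Base P)" "A \<in> Obj (Base P)" "B \<in> Obj (Base P)"
  shows "Pr3_1 (Base P) X A B \<in> Hom (Base P) (Prod3 (Base P) X A B) X"
    and "Pr3_2 (Base P) X A B \<in> Hom (Base P) (Prod3 (Base P) X A B) A"
    and "Pr3_3 (Base P) X A B \<in> Hom (Base P) (Prod3 (Base P) X A B) B"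
  unfolding Pr3_1_def Pr3_2_def Pr3_3_def Prod3_def using assms
  by (blast intro: base.Comp_in_Hom base.Pr_in_Hom base.Prod_in_Obj)+

lemma Pr3_triple:
  assumes x: "x \<in> Hom (Base P) Y X" and f: "f \<in> Hom (Base P) Y A" and g: "g \<in> Hom (Base P) Y B"
  shows "triple (Base P) x f g \<in> Hom (Base P) Y (Prod3 (Base P) X A B)"
    and "Pr3_1 (Base P) X A B \<cdot>\<^bsub>Base P\<^esub> triple (Base P) x f g = x"
    and "Pr3_2 (Base P) X A B \<cdot>\<^bsub>Base P\<^esub> triple (Base P) x f g = f"
    and "Pr3_3 (Base P) X A B \<cdot>\<^bsub>Base P\<^esub> triple (Base P) x f g = g"
proof -
  note obj = base.Hom_Obj(2)[OF x] base.Hom_Obj(2)[OF f] base.Hom_Obj(2)[OF g]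
  note xf = base.pair_in_Hom[OF x f]
  note t = base.pair_in_Hom[OF xf g]
  note p = base.Pr_in_Hom(1)[OF base.Prod_in_Obj[OF obj(1,2)] obj(3)]
  show "triple (Base P) x f g \<in> Hom (Base P) Y (Prod3 (Base P) X A B)"
    using t by (simp add: triple_def Prod3_def)
  show "Pr3_1 (Base P) X A B \<cdot>\<^bsub>Base P\<^esub> triple (Base P) x f g = x"
    "Pr3_2 (Base P) X A B \<cdot>\<^bsub>Base P\<^esub> triple (Base P) x f g = f"
    "Pr3_3 (Base P) X A B \<cdot>\<^bsub>Base P\<^esub> triple (Base P) x f g = g"
    by (simp_all add: triple_def Pr3_1_def Pr3_2_def Pr3_3_def
        base.Comp_assoc[OF t p base.Pr_in_Hom(1)[OF obj(1,2)]]
        base.Comp_assoc[OF t p base.Pr_in_Hom(2)[OF obj(1,2)]]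
        base.Pr1_pair[OF xf g] base.Pr2_pair[OF xf g] base.Pr1_pair[OF x f] base.Pr2_pair[OF x f])
qed

text \<open>The conditions on types and orders in the two adjunctions hold automatically, so being a fibred
  equality comes down to two families of inequalities between reindexed predicates. In this form
  the notion can be compared between a doctrine and its collapse.\<close>

lemma fibred_equality_iff:
  assumes A: "A \<in> Obj (Base P)"
  shows "fibred_equality P A d \<longleftrightarrow>
    d \<in> carrier (Fib P (Prod (Base P) A A)) \<and>
    (\<forall>\<alpha> \<in> carrier (Fib P A). \<forall>\<beta> \<in> carrier (Fib P (Prod (Base P) A A)).
      fib_le (Prod (Base P) A A)
        (Pull P (Pr1 (Base P) A A) \<alpha> \<sqinter>\<^bsub>Fib P (Prod (Base P) A A)\<^esub> d) \<beta>
      \<longleftrightarrow> fib_le A \<alpha> (Pull P (diag (Base P) A) \<beta>)) \<and>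
    (\<forall>X \<in> Obj (Base P). \<forall>\<alpha> \<in> carrier (Fib P (Prod (Base P) X A)).
      \<forall>\<beta> \<in> carrier (Fib P (Prod3 (Base P) X A A)).
      fib_le (Prod3 (Base P) X A A)
        (Pull P (pair (Base P) (Pr3_1 (Base P) X A A) (Pr3_2 (Base P) X A A)) \<alpha>
          \<sqinter>\<^bsub>Fib P (Prod3 (Base P) X A A)\<^esub>
          Pull P (pair (Base P) (Pr3_2 (Base P) X A A) (Pr3_3 (Base P) X A A)) d) \<beta>
      \<longleftrightarrow> fib_le (Prod (Base P) X A) \<alpha>
        (Pull P (triple (Base P) (Pr1 (Base P) X A) (Pr2 (Base P) X A) (Pr2 (Base P) X A)) \<beta>))"
proof -
  note AA = base.Prod_in_Obj[OF A A]
  have 1: "galois_connection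
        \<lparr>orderA = Fib P A, orderB = Fib P (Prod (Base P) A A),
         lower = (\<lambda>\<alpha>. Pull P (Pr1 (Base P) A A) \<alpha> \<sqinter>\<^bsub>Fib P (Prod (Base P) A A)\<^esub> d),
         upper = Pull P (diag (Base P) A)\<rparr> \<longleftrightarrow>
    (\<forall>\<alpha> \<in> carrier (Fib P A). \<forall>\<beta> \<in> carrier (Fib P (Prod (Base P) A A)).
      fib_le (Prod (Base P) A A)
        (Pull P (Pr1 (Base P) A A) \<alpha> \<sqinter>\<^bsub>Fib P (Prod (Base P) A A)\<^esub> d) \<beta>
      \<longleftrightarrow> fib_le A \<alpha> (Pull P (diag (Base P) A) \<beta>))"
    if "d \<in> carrier (Fib P (Prod (Base P) A A))"
    unfolding galois_connection_def galois_connection_axioms_def connection_def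
    using fib_order[OF A] fib_order[OF AA] that
      Pull_closed[OF base.Pr_in_Hom(1)[OF A A]] Pull_closed[OF base.diag_in_Hom[OF A]]
      meet_closed[OF AA]
    by auto
  have 2: "galois_connection
      \<lparr>orderA = Fib P (Prod (Base P) X A), orderB = Fib P (Prod3 (Base P) X A A),
       lower = (\<lambda>\<alpha>.
        Pull P (pair (Base P) (Pr3_1 (Base P) X A A) (Pr3_2 (Base P) X A A)) \<alpha>
          \<sqinter>\<^bsub>Fib P (Prod3 (Base P) X A A)\<^esub>
          Pull P (pair (Base P) (Pr3_2 (Base P) X A A) (Pr3_3 (Base P) X A A)) d),
       upper = Pull P (triple (Base P) (Pr1 (Base P) X A) (Pr2 (Base P) X A)
          (Pr2 (Base P) X A))\<rparr> \<longleftrightarrow>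
    (\<forall>\<alpha> \<in> carrier (Fib P (Prod (Base P) X A)).
      \<forall>\<beta> \<in> carrier (Fib P (Prod3 (Base P) X A A)).
      fib_le (Prod3 (Base P) X A A)
        (Pull P (pair (Base P) (Pr3_1 (Base P) X A A) (Pr3_2 (Base P) X A A)) \<alpha>
          \<sqinter>\<^bsub>Fib P (Prod3 (Base P) X A A)\<^esub>
          Pull P (pair (Base P) (Pr3_2 (Base P) X A A) (Pr3_3 (Base P) X A A)) d) \<beta>
      \<longleftrightarrow> fib_le (Prod (Base P) X A) \<alpha>
        (Pull P (triple (Base P) (Pr1 (Base P) X A) (Pr2 (Base P) X A) (Pr2 (Base P) X A)) \<beta>))"
    if d: "d \<in> carrier (Fib P (Prod (Base P) A A))" and X: "X \<in> Obj (Base P)" for X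
  proof -
    note XA = base.Prod_in_Obj[OF X A]
    have XAA: "Prod3 (Base P) X A A \<in> Obj (Base P)"
      unfolding Prod3_def by (rule base.Prod_in_Obj[OF XA A])
    note q = Pr3_in_Hom[OF X A A]
    note t = Pr3_triple(1)[OF base.Pr_in_Hom(1,2)[OF X A] base.Pr_in_Hom(2)[OF X A]]
    show ?thesis
      unfolding galois_connection_def galois_connection_axioms_def connection_def
      using fib_order[OF XA] fib_order[OF XAA] Pull_closed[OF t]
        Pull_closed[OF base.pair_in_Hom[OF q(1,2)]]
        Pull_closed[OF base.pair_in_Hom[OF q(2,3)] d] meet_closed[OF XAA]
      by auto
  qed
  show ?thesis
    unfolding fibred_equality_def Let_def using 1 2 by (simp cong: conj_cong)
qed

end


section \<open>Arrows that the fibred equality makes equal\<close>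

text \<open>The doctrine forces \<open>f = g\<close> when the predicate \<open>f(y) = g(y)\<close> on the domain is true. The
  collapse identifies precisely such arrows, and comprehensive diagonals say that different
  arrows are never so related.\<close>

definition internally_equal :: "('o, 'a, 'p) doctrine \<Rightarrow> 'a \<Rightarrow> 'a \<Rightarrow> bool" where
  "internally_equal P f g \<longleftrightarrow>
    Pull P (pair (Base P) f g) (delta P (Cod (Base P) f)) = \<top>\<^bsub>Fib P (Dom (Base P) f)\<^esub>"

lemma internally_equal_iff:
  "f \<in> Hom (Base P) Y A \<Longrightarrow>
    internally_equal P f g \<longleftrightarrow> Pull P (pair (Base P) f g) (delta P A) = \<top>\<^bsub>Fib P Y\<^esub>"
  by (simp add: internally_equal_def Hom_Dom Hom_Cod)

context inf_semilattice_doctrine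
begin

text \<open>Transposing \<open>\<top>\<close> along the first adjunction: a fibred equality is the least reflexive
  predicate, and this determines it.\<close>

lemma fibred_equality_le_iff:
  assumes A: "A \<in> Obj (Base P)" and d: "fibred_equality P A d"
    and b: "\<beta> \<in> carrier (Fib P (Prod (Base P) A A))"
  shows "fib_le (Prod (Base P) A A) d \<beta> \<longleftrightarrow> Pull P (diag (Base P) A) \<beta> = \<top>\<^bsub>Fib P A\<^esub>"
proof -
  note AA = base.Prod_in_Obj[OF A A]
  note eq = d[unfolded fibred_equality_iff[OF A]]
  have "Pull P (Pr1 (Base P) A A) \<top>\<^bsub>Fib P A\<^esub> \<sqinter>\<^bsub>Fib P (Prod (Base P) A A)\<^esub> d = d"
    using eq by (simp add: Pull_top[OF base.Pr_in_Hom(1)[OF A A]] top_meet[OF AA])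
  with eq b top_closed[OF A]
  have "fib_le (Prod (Base P) A A) d \<beta> \<longleftrightarrow>
      fib_le A \<top>\<^bsub>Fib P A\<^esub> (Pull P (diag (Base P) A) \<beta>)"
    by metis
  then show ?thesis
    by (simp add: top_le_iff[OF A Pull_closed[OF base.diag_in_Hom[OF A] b]])
qed

lemma fibred_equality_unique:
  assumes A: "A \<in> Obj (Base P)" and d: "fibred_equality P A d" and e: "fibred_equality P A e"
  shows "d = e"
proof -
  note AA = base.Prod_in_Obj[OF A A]
  have dc: "d \<in> carrier (Fib P (Prod (Base P) A A))" and ec: "e \<in> carrier (Fib P (Prod (Base P) A A))"
    using d e by (simp_all add: fibred_equality_iff[OF A])
  show ?thesis
    using fibred_equality_le_iff[OF A d] fibred_equality_le_iff[OF A e] dc ec fib_refl[OF AA]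
    by (intro fib_antisym[OF AA _ _ dc ec]) blast+
qed

lemma delta_eqI: "A \<in> Obj (Base P) \<Longrightarrow> fibred_equality P A d \<Longrightarrow> delta P A = d"
  unfolding delta_def using fibred_equality_unique by blast

end

context elementary_doctrine
begin

lemma delta_fibred_equality: "A \<in> Obj (Base P) \<Longrightarrow> fibred_equality P A (delta P A)"
  using fibred_equality_exists delta_eqI by metis

lemma delta_closed:
  "A \<in> Obj (Base P) \<Longrightarrow> delta P A \<in> carrier (Fib P (Prod (Base P) A A))"
  using delta_fibred_equality by (simp add: fibred_equality_iff)

lemma delta_le_iff:
  "A \<in> Obj (Base P) \<Longrightarrow> \<beta> \<in> carrier (Fib P (Prod (Base P) A A)) \<Longrightarrow>
    fib_le (Prod (Base P) A A) (delta P A) \<beta> \<longleftrightarrow> Pull P (diag (Base P) A) \<beta> = \<top>\<^bsub>Fib P A\<^esub>"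
  using fibred_equality_le_iff delta_fibred_equality by blast

lemma Pull_diag_delta: "A \<in> Obj (Base P) \<Longrightarrow> Pull P (diag (Base P) A) (delta P A) = \<top>\<^bsub>Fib P A\<^esub>"
  using delta_le_iff delta_closed fib_refl base.Prod_in_Obj by metis

lemma internally_equal_refl:
  assumes f: "f \<in> Hom (Base P) Y A"
  shows "internally_equal P f f"
proof -
  note A = base.Hom_Obj(2)[OF f]
  have "Pull P (diag (Base P) A \<cdot>\<^bsub>Base P\<^esub> f) (delta P A) = \<top>\<^bsub>Fib P Y\<^esub>"
    using Pull_Comp[OF f base.diag_in_Hom[OF A] delta_closed[OF A]] Pull_diag_delta[OF A]
      Pull_top[OF f] by simp
  then show ?thesis
    by (simp add: internally_equal_iff[OF f] base.diag_Comp[OF f])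
qed

text \<open>Substitution of equals for equals, with a parameter \<open>x\<close>: this is the content of the adjunction
  along \<open>X \<times> A \<rightarrow> X \<times> A \<times> A\<close>. Symmetry, transitivity and the congruence rules come from suitable
  choices of \<open>\<beta>\<close>.\<close>

lemma Pull_pair_le:
  assumes x: "x \<in> Hom (Base P) Y X" and f: "f \<in> Hom (Base P) Y A" and g: "g \<in> Hom (Base P) Y A"
    and fg: "internally_equal P f g" and b: "\<beta> \<in> carrier (Fib P (Prod (Base P) X A))"
  shows "fib_le Y (Pull P (pair (Base P) x f) \<beta>) (Pull P (pair (Base P) x g) \<beta>)"
proof -
  note X = base.Hom_Obj(2)[OF x] and A = base.Hom_Obj(2)[OF f] and Y = base.Hom_Obj(1)[OF f]
  let ?C = "Base P"
  let ?XA = "Prod ?C X A" and ?XAA = "Prod3 ?C X A A"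
  let ?e = "triple ?C (Pr1 ?C X A) (Pr2 ?C X A) (Pr2 ?C X A)"
  let ?p12 = "pair ?C (Pr3_1 ?C X A A) (Pr3_2 ?C X A A)"
  let ?p23 = "pair ?C (Pr3_2 ?C X A A) (Pr3_3 ?C X A A)"
  let ?p13 = "pair ?C (Pr3_1 ?C X A A) (Pr3_3 ?C X A A)"
  let ?t = "triple ?C x f g"
  note XA = base.Prod_in_Obj[OF X A]
  have XAA: "?XAA \<in> Obj ?C"
    unfolding Prod3_def by (rule base.Prod_in_Obj[OF XA A])
  note q = Pr3_in_Hom[OF X A A]
  note p12 = base.pair_in_Hom[OF q(1,2)] and p23 = base.pair_in_Hom[OF q(2,3)]
    and p13 = base.pair_in_Hom[OF q(1,3)]
  note pr = base.Pr_in_Hom[OF X A]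
  note e = Pr3_triple[OF pr pr(2)] and t = Pr3_triple[OF x f g]
  note d = delta_closed[OF A]
  note c12 = Pull_closed[OF p12 b] and c23 = Pull_closed[OF p23 d] and c13 = Pull_closed[OF p13 b]
  \<comment> \<open>The generic case \<open>\<beta>(x, a) \<and> a = a' \<le> \<beta>(x, a')\<close> over \<open>X \<times> A \<times> A\<close>: its transpose is
    \<open>\<beta> \<le> \<beta>\<close>, because \<open>\<langle>pr\<^sub>1, pr\<^sub>3\<rangle>\<close> is a retraction of \<open>e\<close>.\<close>
  have "?p13 \<cdot>\<^bsub>?C\<^esub> ?e = Ide ?C ?XA"
    using base.pair_eta[OF base.Ide_in_Hom[OF XA] X A] e
    by (simp add: base.pair_Comp[OF q(1,3) e(1)] base.Comp_Ide[OF pr(1)] base.Comp_Ide[OF pr(2)])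
  then have "Pull P ?e (Pull P ?p13 \<beta>) = \<beta>"
    using Pull_Comp[OF e(1) p13 b] Pull_Ide[OF XA b] by simp
  then have "fib_le ?XA \<beta> (Pull P ?e (Pull P ?p13 \<beta>))"
    by (simp add: fib_refl[OF XA b])
  then have "fib_le ?XAA (Pull P ?p12 \<beta> \<sqinter>\<^bsub>Fib P ?XAA\<^esub> Pull P ?p23 (delta P A))
      (Pull P ?p13 \<beta>)"
    using delta_fibred_equality[OF A] fibred_equality_iff[OF A] X b c13 by blast
  \<comment> \<open>Now specialise to \<open>(x, f, g)\<close>; the equality conjunct becomes \<open>\<top>\<close> by hypothesis.\<close>
  from Pull_mono[OF t(1) meet_closed[OF XAA c12 c23] c13 this]
  have "fib_le Y (Pull P ?t (Pull P ?p12 \<beta>) \<sqinter>\<^bsub>Fib P Y\<^esub> Pull P ?t (Pull P ?p23 (delta P A)))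
      (Pull P ?t (Pull P ?p13 \<beta>))"
    by (simp add: Pull_meet[OF t(1) c12 c23])
  moreover have "Pull P ?t (Pull P ?p12 \<beta>) = Pull P (pair ?C x f) \<beta>"
    by (simp add: Pull_Comp[OF t(1) p12 b, symmetric] base.pair_Comp[OF q(1,2) t(1)] t(2-))
  moreover have "Pull P ?t (Pull P ?p13 \<beta>) = Pull P (pair ?C x g) \<beta>"
    by (simp add: Pull_Comp[OF t(1) p13 b, symmetric] base.pair_Comp[OF q(1,3) t(1)] t(2-))
  moreover have "Pull P ?t (Pull P ?p23 (delta P A)) = \<top>\<^bsub>Fib P Y\<^esub>"
    using fg internally_equal_iff[OF f]
    by (simp add: Pull_Comp[OF t(1) p23 d, symmetric] base.pair_Comp[OF q(2,3) t(1)] t(2-))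
  ultimately show ?thesis
    using meet_eq_left[OF Y Pull_closed[OF base.pair_in_Hom[OF x f] b] top_closed[OF Y]
        le_top[OF Y Pull_closed[OF base.pair_in_Hom[OF x f] b]]] by simp
qed

text \<open>Substitute \<open>g\<close> for the second \<open>f\<close> in the predicate \<open>a' = a\<close>, which holds at \<open>(f, f)\<close>.\<close>

lemma internally_equal_sym:
  assumes f: "f \<in> Hom (Base P) Y A" and g: "g \<in> Hom (Base P) Y A"
    and fg: "internally_equal P f g"
  shows "internally_equal P g f"
proof -
  note A = base.Hom_Obj(2)[OF f] and Y = base.Hom_Obj(1)[OF f]
  let ?swap = "pair (Base P) (Pr2 (Base P) A A) (Pr1 (Base P) A A)"
  note pr = base.Pr_in_Hom[OF A A]
  have swap: "?swap \<in> Hom (Base P) (Prod (Base P) A A) (Prod (Base P) A A)"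
    by (rule base.pair_in_Hom[OF pr(2,1)])
  have *: "Pull P (pair (Base P) h k) (Pull P ?swap (delta P A)) = Pull P (pair (Base P) k h) (delta P A)"
    if h: "h \<in> Hom (Base P) Y A" and k: "k \<in> Hom (Base P) Y A" for h k
    by (simp add: Pull_Comp[OF base.pair_in_Hom[OF h k] swap delta_closed[OF A], symmetric]
        base.pair_Comp[OF pr(2,1) base.pair_in_Hom[OF h k]] base.Pr1_pair[OF h k]
        base.Pr2_pair[OF h k])
  have "fib_le Y \<top>\<^bsub>Fib P Y\<^esub> (Pull P (pair (Base P) g f) (delta P A))"
    using Pull_pair_le[OF f f g fg Pull_closed[OF swap delta_closed[OF A]]]
      internally_equal_refl[OF f]
    by (simp add: *[OF f f] *[OF f g] internally_equal_iff[OF f])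
  then show ?thesis
    using top_le_iff[OF Y Pull_closed[OF base.pair_in_Hom[OF g f] delta_closed[OF A]]]
    by (simp add: internally_equal_iff[OF g])
qed

lemma Pull_pair_cong:
  assumes x: "x \<in> Hom (Base P) Y X" and f: "f \<in> Hom (Base P) Y A" and g: "g \<in> Hom (Base P) Y A"
    and fg: "internally_equal P f g" and b: "\<beta> \<in> carrier (Fib P (Prod (Base P) X A))"
  shows "Pull P (pair (Base P) x f) \<beta> = Pull P (pair (Base P) x g) \<beta>"
  using Pull_pair_le[OF x f g fg b] Pull_pair_le[OF x g f internally_equal_sym[OF f g fg] b]
    fib_antisym[OF base.Hom_Obj(1)[OF f]] Pull_closed[OF base.pair_in_Hom[OF x f] b]
    Pull_closed[OF base.pair_in_Hom[OF x g] b] by blast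

lemma internally_equal_trans:
  assumes f: "f \<in> Hom (Base P) Y A" and g: "g \<in> Hom (Base P) Y A" and h: "h \<in> Hom (Base P) Y A"
    and "internally_equal P f g" "internally_equal P g h"
  shows "internally_equal P f h"
  using Pull_pair_cong[OF f g h _ delta_closed[OF base.Hom_Obj(2)[OF f]]] assms(4,5)
  by (simp add: internally_equal_iff[OF f])

lemma Pull_cong:
  assumes f: "f \<in> Hom (Base P) Y A" and g: "g \<in> Hom (Base P) Y A"
    and fg: "internally_equal P f g" and b: "\<beta> \<in> carrier (Fib P A)"
  shows "Pull P f \<beta> = Pull P g \<beta>"
proof -
  note A = base.Hom_Obj(2)[OF f]
  note pr = base.Pr_in_Hom(2)[OF A A]
  show ?thesis
    using Pull_pair_cong[OF f f g fg Pull_closed[OF pr b]]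
    by (simp add: Pull_Comp[OF base.pair_in_Hom[OF f f] pr b, symmetric]
        Pull_Comp[OF base.pair_in_Hom[OF f g] pr b, symmetric]
        base.Pr2_pair[OF f f] base.Pr2_pair[OF f g])
qed

text \<open>Substituting \<open>g\<close> for \<open>f\<close> in the true predicate \<open>h(x, f) = h(x, f)\<close>. Suitable choices of \<open>h\<close> give
  the congruence rules for composition and for pairing.\<close>

lemma internally_equal_Comp_pair:
  assumes x: "x \<in> Hom (Base P) Y X" and f: "f \<in> Hom (Base P) Y A" and g: "g \<in> Hom (Base P) Y A"
    and fg: "internally_equal P f g" and h: "h \<in> Hom (Base P) (Prod (Base P) X A) B"
  shows "internally_equal P (h \<cdot>\<^bsub>Base P\<^esub> pair (Base P) x f) (h \<cdot>\<^bsub>Base P\<^esub> pair (Base P) x g)"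
proof -
  let ?C = "Base P"
  note X = base.Hom_Obj(2)[OF x] and A = base.Hom_Obj(2)[OF f] and B = base.Hom_Obj(2)[OF h]
  let ?W = "Prod ?C X A"
  let ?xf = "pair ?C x f"
  note W = base.Prod_in_Obj[OF X A]
  note xf = base.pair_in_Hom[OF x f]
  note p = base.Pr_in_Hom[OF W A] and q = base.Pr_in_Hom[OF X A]
  note qp = base.Comp_in_Hom[OF p(1) q(1)]
  note r = base.pair_in_Hom[OF qp p(2)]
  \<comment> \<open>In context \<open>(X \<times> A) \<times> A\<close> the predicate \<open>h(x, a) = h(x, a')\<close> in the variables \<open>((x, a), a')\<close>\<close>
  let ?s = "pair ?C (h \<cdot>\<^bsub>?C\<^esub> Pr1 ?C ?W A) (h \<cdot>\<^bsub>?C\<^esub> pair ?C (Pr1 ?C X A \<cdot>\<^bsub>?C\<^esub> Pr1 ?C ?W A) (Pr2 ?C ?W A))"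
  note hp = base.Comp_in_Hom[OF p(1) h] and hr = base.Comp_in_Hom[OF r h]
  note s = base.pair_in_Hom[OF hp hr]
  have *: "Pull P (pair ?C ?xf k) (Pull P ?s (delta P B)) =
      Pull P (pair ?C (h \<cdot>\<^bsub>?C\<^esub> ?xf) (h \<cdot>\<^bsub>?C\<^esub> pair ?C x k)) (delta P B)"
    if k: "k \<in> Hom ?C Y A" for k
  proof -
    note xk = base.pair_in_Hom[OF xf k]
    show ?thesis
      by (simp add: Pull_Comp[OF xk s delta_closed[OF B], symmetric] base.pair_Comp[OF hp hr xk]
          base.Comp_assoc[OF xk p(1) h] base.Comp_assoc[OF xk r h] base.pair_Comp[OF qp p(2) xk]
          base.Comp_assoc[OF xk p(1) q(1)] base.Pr1_pair[OF xf k] base.Pr2_pair[OF xf k]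
          base.Pr1_pair[OF x f])
  qed
  note hxf = base.Comp_in_Hom[OF xf h]
  show ?thesis
    using Pull_pair_cong[OF xf f g fg Pull_closed[OF s delta_closed[OF B]]]
      internally_equal_refl[OF hxf]
    by (simp add: *[OF f] *[OF g] internally_equal_iff[OF hxf])
qed

lemma internally_equal_Comp:
  assumes f: "f \<in> Hom (Base P) Y A" and f': "f' \<in> Hom (Base P) Y A"
    and g: "g \<in> Hom (Base P) A B" and g': "g' \<in> Hom (Base P) A B"
    and ff: "internally_equal P f f'" and gg: "internally_equal P g g'"
  shows "internally_equal P (g \<cdot>\<^bsub>Base P\<^esub> f) (g' \<cdot>\<^bsub>Base P\<^esub> f')"
proof -
  note A = base.Hom_Obj(2)[OF f] and B = base.Hom_Obj(2)[OF g]
  note pr = base.Pr_in_Hom(2)[OF A A]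
  have *: "(g \<cdot>\<^bsub>Base P\<^esub> Pr2 (Base P) A A) \<cdot>\<^bsub>Base P\<^esub> pair (Base P) f k = g \<cdot>\<^bsub>Base P\<^esub> k"
    if k: "k \<in> Hom (Base P) Y A" for k
    by (simp add: base.Comp_assoc[OF base.pair_in_Hom[OF f k] pr g] base.Pr2_pair[OF f k])
  have 1: "internally_equal P (g \<cdot>\<^bsub>Base P\<^esub> f) (g \<cdot>\<^bsub>Base P\<^esub> f')"
    using internally_equal_Comp_pair[OF f f f' ff base.Comp_in_Hom[OF pr g]]
    by (simp add: *[OF f] *[OF f'])
  note gf = base.Comp_in_Hom[OF f' g] and gf' = base.Comp_in_Hom[OF f' g']
  have "Pull P (pair (Base P) g g' \<cdot>\<^bsub>Base P\<^esub> f') (delta P B) = \<top>\<^bsub>Fib P Y\<^esub>"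
    using gg by (simp add: Pull_Comp[OF f' base.pair_in_Hom[OF g g'] delta_closed[OF B]]
        internally_equal_iff[OF g] Pull_top[OF f'])
  then have 2: "internally_equal P (g \<cdot>\<^bsub>Base P\<^esub> f') (g' \<cdot>\<^bsub>Base P\<^esub> f')"
    by (simp add: internally_equal_iff[OF gf] base.pair_Comp[OF g g' f'])
  show ?thesis
    by (rule internally_equal_trans[OF base.Comp_in_Hom[OF f g] gf gf' 1 2])
qed

text \<open>Stability under pairing is what makes products survive the collapse: it yields uniqueness of
  the mediating class. One component is replaced at a time, the first one after a swap.\<close>

lemma internally_equal_pair:
  assumes f: "f \<in> Hom (Base P) Y A" and f': "f' \<in> Hom (Base P) Y A"
    and g: "g \<in> Hom (Base P) Y B" and g': "g' \<in> Hom (Base P) Y B"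
    and ff: "internally_equal P f f'" and gg: "internally_equal P g g'"
  shows "internally_equal P (pair (Base P) f g) (pair (Base P) f' g')"
proof -
  note A = base.Hom_Obj(2)[OF f] and B = base.Hom_Obj(2)[OF g]
  note AB = base.Prod_in_Obj[OF A B]
  note pr = base.Pr_in_Hom[OF B A]
  let ?swap = "pair (Base P) (Pr2 (Base P) B A) (Pr1 (Base P) B A)"
  have swap: "?swap \<cdot>\<^bsub>Base P\<^esub> pair (Base P) g k = pair (Base P) k g"
    if k: "k \<in> Hom (Base P) Y A" for k
    by (simp add: base.pair_Comp[OF pr(2,1) base.pair_in_Hom[OF g k]] base.Pr1_pair[OF g k]
        base.Pr2_pair[OF g k])
  have 1: "internally_equal P (pair (Base P) f g) (pair (Base P) f' g)"
    using internally_equal_Comp_pair[OF g f f' ff base.pair_in_Hom[OF pr(2,1)]]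
    by (simp add: swap[OF f] swap[OF f'])
  have 2: "internally_equal P (pair (Base P) f' g) (pair (Base P) f' g')"
    using internally_equal_Comp_pair[OF f' g g' gg base.Ide_in_Hom[OF AB]]
    by (simp add: base.Ide_Comp[OF base.pair_in_Hom[OF f' g]]
        base.Ide_Comp[OF base.pair_in_Hom[OF f' g']])
  show ?thesis
    by (rule internally_equal_trans[OF base.pair_in_Hom[OF f g] base.pair_in_Hom[OF f' g]
          base.pair_in_Hom[OF f' g'] 1 2])
qed

text \<open>Since \<open>\<delta>\<^sub>A\<close> is the least reflexive predicate, comparing it with \<open>P\<^bsub>f\<times>g\<^esub>(\<delta>\<^sub>B)\<close> only requires
  restricting the latter to the diagonal, where it becomes \<open>f(a) = g(a)\<close>. In particular every
  arrow is extensional.\<close>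

lemma delta_le_prod_arr_iff:
  assumes f: "f \<in> Hom (Base P) A B" and g: "g \<in> Hom (Base P) A B"
  shows "fib_le (Prod (Base P) A A) (delta P A) (Pull P (prod_arr (Base P) f g) (delta P B))
    \<longleftrightarrow> internally_equal P f g"
proof -
  note A = base.Hom_Obj(1)[OF f] and B = base.Hom_Obj(2)[OF f]
  note fg = base.prod_arr_in_Hom[OF f g]
  note I = base.Ide_in_Hom[OF A]
  have "prod_arr (Base P) f g \<cdot>\<^bsub>Base P\<^esub> diag (Base P) A = pair (Base P) f g"
    unfolding diag_def
    by (simp add: base.prod_arr_pair[OF f g I I] base.Comp_Ide[OF f] base.Comp_Ide[OF g])
  then show ?thesis
    using Pull_Comp[OF base.diag_in_Hom[OF A] fg delta_closed[OF B]]
    by (simp add: delta_le_iff[OF A Pull_closed[OF fg delta_closed[OF B]]]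
        internally_equal_iff[OF f])
qed

lemma ext_arrows_eq_Hom: "ext_arrows P A B = Hom (Base P) A B"
  unfolding ext_arrows_def using delta_le_prod_arr_iff internally_equal_refl by blast

lemma ext_rel_iff:
  "(f, g) \<in> ext_rel P A B \<longleftrightarrow>
    f \<in> Hom (Base P) A B \<and> g \<in> Hom (Base P) A B \<and> internally_equal P f g"
  unfolding ext_rel_def ext_arrows_eq_Hom using delta_le_prod_arr_iff by blast

lemma equiv_ext_rel: "equiv (Hom (Base P) A B) (ext_rel P A B)"
  by (intro equivI refl_onI symI transI)
    (auto simp: ext_rel_iff intro: internally_equal_refl internally_equal_sym internally_equal_trans)

end


section \<open>The extensional collapse\<close>

lemma ext_category_simps [simp]:
  "Obj (ext_category P) = Obj (Base P)"
  "Ide (ext_category P) A = ext_class P (Ide (Base P) A)"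
  "Prod (ext_category P) = Prod (Base P)"
  "Pr1 (ext_category P) A B = ext_class P (Pr1 (Base P) A B)"
  "Pr2 (ext_category P) A B = ext_class P (Pr2 (Base P) A B)"
  by (simp_all add: ext_category_def)

lemma ext_collapse_simps [simp]:
  "Base (ext_collapse P) = ext_category P"
  "Fib (ext_collapse P) = Fib P"
  "Pull (ext_collapse P) \<phi> = Pull P (rep \<phi>)"
  by (simp_all add: ext_collapse_def)

context elementary_doctrine
begin

lemma ext_class_eq: "f \<in> Hom (Base P) A B \<Longrightarrow> ext_class P f = ext_rel P A B `` {f}"
  by (simp add: ext_class_def Hom_Dom Hom_Cod)

lemma ext_class_eq_iff:
  assumes f: "f \<in> Hom (Base P) A B" and g: "g \<in> Hom (Base P) A B"
  shows "ext_class P f = ext_class P g \<longleftrightarrow> internally_equal P f g"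
  using eq_equiv_class_iff[OF equiv_ext_rel f g]
  by (simp add: ext_class_eq[OF f] ext_class_eq[OF g] ext_rel_iff f g)

lemma rep_ext_class:
  assumes f: "f \<in> Hom (Base P) A B"
  shows "rep (ext_class P f) \<in> Hom (Base P) A B"
    and "internally_equal P f (rep (ext_class P f))"
    and "ext_class P (rep (ext_class P f)) = ext_class P f"
proof -
  have "f \<in> ext_class P f"
    by (simp add: ext_class_eq[OF f] ext_rel_iff f internally_equal_refl[OF f])
  then have "rep (ext_class P f) \<in> ext_class P f"
    unfolding rep_def by (rule someI)
  then show 1: "rep (ext_class P f) \<in> Hom (Base P) A B" "internally_equal P f (rep (ext_class P f))"
    by (simp_all add: ext_class_eq[OF f] ext_rel_iff)
  show "ext_class P (rep (ext_class P f)) = ext_class P f"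
    using ext_class_eq_iff[OF f 1(1)] 1(2) by simp
qed

text \<open>Everything about the collapse can therefore be checked on classes \<open>ext_class P f\<close>, instead of
  on the representatives picked by \<open>rep\<close>.\<close>

lemma Hom_ext_category: "Hom (ext_category P) A B = ext_class P ` Hom (Base P) A B"
proof (intro equalityI subsetI)
  fix \<phi> assume \<phi>: "\<phi> \<in> Hom (ext_category P) A B"
  then obtain A' B' f where f: "f \<in> Hom (Base P) A' B'" and "\<phi> = ext_rel P A' B' `` {f}"
    unfolding Hom_def[of "ext_category P"]
    by (auto simp: ext_category_def ext_arrows_eq_Hom quotient_def)
  then have \<phi>f: "\<phi> = ext_class P f"
    by (simp add: ext_class_eq[OF f])
  have "A' = A" "B' = B"
    using \<phi> rep_ext_class(1)[OF f] unfolding Hom_def by (auto simp: \<phi>f ext_category_def)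
  then show "\<phi> \<in> ext_class P ` Hom (Base P) A B"
    using f \<phi>f by blast
next
  fix \<phi> assume "\<phi> \<in> ext_class P ` Hom (Base P) A B"
  then obtain f where f: "f \<in> Hom (Base P) A B" and \<phi>: "\<phi> = ext_class P f"
    by blast
  have "\<phi> \<in> Hom (Base P) A B // ext_rel P A B"
    unfolding \<phi> ext_class_eq[OF f] by (rule quotientI[OF f])
  then show "\<phi> \<in> Hom (ext_category P) A B"
    using rep_ext_class(1)[OF f] base.Hom_Obj[OF f]
    unfolding Hom_def[of "ext_category P"]
    by (auto simp: ext_category_def ext_arrows_eq_Hom \<phi> Hom_Dom Hom_Cod)
qed

lemma ext_class_in_Hom: "f \<in> Hom (Base P) A B \<Longrightarrow> ext_class P f \<in> Hom (ext_category P) A B"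
  by (simp add: Hom_ext_category)

lemma rep_in_Hom:
  assumes "\<phi> \<in> Hom (ext_category P) A B"
  shows "rep \<phi> \<in> Hom (Base P) A B" and "ext_class P (rep \<phi>) = \<phi>"
  using assms rep_ext_class by (auto simp: Hom_ext_category)

lemma ext_class_Comp:
  assumes f: "f \<in> Hom (Base P) A B" and g: "g \<in> Hom (Base P) B D"
  shows "ext_class P g \<cdot>\<^bsub>ext_category P\<^esub> ext_class P f = ext_class P (g \<cdot>\<^bsub>Base P\<^esub> f)"
proof -
  note rf = rep_ext_class[OF f] and rg = rep_ext_class[OF g]
  have "ext_class P (g \<cdot>\<^bsub>Base P\<^esub> f) = ext_class P (rep (ext_class P g) \<cdot>\<^bsub>Base P\<^esub> rep (ext_class P f))"
    using ext_class_eq_iff[OF base.Comp_in_Hom[OF f g] base.Comp_in_Hom[OF rf(1) rg(1)]]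
      internally_equal_Comp[OF f rf(1) g rg(1) rf(2) rg(2)] by simp
  then show ?thesis
    by (simp add: ext_category_def)
qed

lemma Pull_rep_ext_class:
  assumes f: "f \<in> Hom (Base P) A B" and "\<beta> \<in> carrier (Fib P B)"
  shows "Pull P (rep (ext_class P f)) \<beta> = Pull P f \<beta>"
  using Pull_cong[OF f rep_ext_class(1,2)[OF f] assms(2)] by simp

lemma category_ext_category: "category (ext_category P)"
proof
  show "Dom (ext_category P) \<phi> \<in> Obj (ext_category P)" if "\<phi> \<in> Arr (ext_category P)" for \<phi>
    using rep_in_Hom(1)[OF HomI[OF that]] base.Hom_Obj by auto
  show "Cod (ext_category P) \<phi> \<in> Obj (ext_category P)" if "\<phi> \<in> Arr (ext_category P)" for \<phi>
    using rep_in_Hom(1)[OF HomI[OF that]] base.Hom_Obj by auto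
  show "Ide (ext_category P) A \<in> Hom (ext_category P) A A" if "A \<in> Obj (ext_category P)" for A
    using that base.Ide_in_Hom by (simp add: Hom_ext_category)
next
  fix \<phi> \<psi> A B D
  assume "\<phi> \<in> Hom (ext_category P) A B" "\<psi> \<in> Hom (ext_category P) B D"
  then show "\<psi> \<cdot>\<^bsub>ext_category P\<^esub> \<phi> \<in> Hom (ext_category P) A D"
    by (auto simp: Hom_ext_category ext_class_Comp intro: base.Comp_in_Hom)
next
  fix \<phi> A B
  assume "\<phi> \<in> Hom (ext_category P) A B"
  then obtain f where f: "f \<in> Hom (Base P) A B" and \<phi>: "\<phi> = ext_class P f"
    by (auto simp: Hom_ext_category)
  show "\<phi> \<cdot>\<^bsub>ext_category P\<^esub> Ide (ext_category P) A = \<phi>"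
    by (simp add: \<phi> ext_class_Comp[OF base.Ide_in_Hom[OF base.Hom_Obj(1)[OF f]] f] base.Comp_Ide[OF f])
  show "Ide (ext_category P) B \<cdot>\<^bsub>ext_category P\<^esub> \<phi> = \<phi>"
    by (simp add: \<phi> ext_class_Comp[OF f base.Ide_in_Hom[OF base.Hom_Obj(2)[OF f]]] base.Ide_Comp[OF f])
next
  fix \<phi> \<psi> \<chi> A B D E
  assume "\<phi> \<in> Hom (ext_category P) A B" "\<psi> \<in> Hom (ext_category P) B D"
    "\<chi> \<in> Hom (ext_category P) D E"
  then obtain f g h where f: "f \<in> Hom (Base P) A B" "\<phi> = ext_class P f"
    and g: "g \<in> Hom (Base P) B D" "\<psi> = ext_class P g"
    and h: "h \<in> Hom (Base P) D E" "\<chi> = ext_class P h"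
    unfolding Hom_ext_category by blast
  show "(\<chi> \<cdot>\<^bsub>ext_category P\<^esub> \<psi>) \<cdot>\<^bsub>ext_category P\<^esub> \<phi> = \<chi> \<cdot>\<^bsub>ext_category P\<^esub> (\<psi> \<cdot>\<^bsub>ext_category P\<^esub> \<phi>)"
    by (simp add: f(2) g(2) h(2) ext_class_Comp[OF f(1) g(1)] ext_class_Comp[OF g(1) h(1)]
        ext_class_Comp[OF f(1) base.Comp_in_Hom[OF g(1) h(1)]]
        ext_class_Comp[OF base.Comp_in_Hom[OF f(1) g(1)] h(1)] base.Comp_assoc[OF f(1) g(1) h(1)])
qed

text \<open>A class \<open>[h]\<close> with the same components as \<open>[\<langle>f, g\<rangle>]\<close> has components internally equal to \<open>f\<close>
  and \<open>g\<close>; internal equality is stable under pairing, so \<open>[h] = [\<langle>f, g\<rangle>]\<close>.\<close>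

lemma is_product_ext_category:
  assumes A: "A \<in> Obj (Base P)" and B: "B \<in> Obj (Base P)"
  shows "is_product (ext_category P) A B (Prod (Base P) A B)
    (ext_class P (Pr1 (Base P) A B)) (ext_class P (Pr2 (Base P) A B))"
  unfolding is_product_def
proof (intro conjI allI ballI)
  note p = base.Pr_in_Hom(1)[OF A B] and q = base.Pr_in_Hom(2)[OF A B]
  let ?p = "ext_class P (Pr1 (Base P) A B)" and ?q = "ext_class P (Pr2 (Base P) A B)"
  show "?p \<in> Hom (ext_category P) (Prod (Base P) A B) A" "?q \<in> Hom (ext_category P) (Prod (Base P) A B) B"
    by (simp_all add: ext_class_in_Hom p q)
  fix Y \<phi> \<psi>
  assume "\<phi> \<in> Hom (ext_category P) Y A" "\<psi> \<in> Hom (ext_category P) Y B"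
  then obtain f g where f: "f \<in> Hom (Base P) Y A" and \<phi>: "\<phi> = ext_class P f"
    and g: "g \<in> Hom (Base P) Y B" and \<psi>: "\<psi> = ext_class P g"
    unfolding Hom_ext_category by blast
  note fg = base.pair_in_Hom[OF f g]
  show "\<exists>!\<chi>. \<chi> \<in> Hom (ext_category P) Y (Prod (Base P) A B) \<and>
      ?p \<cdot>\<^bsub>ext_category P\<^esub> \<chi> = \<phi> \<and> ?q \<cdot>\<^bsub>ext_category P\<^esub> \<chi> = \<psi>"
  proof (rule ex1I[of _ "ext_class P (pair (Base P) f g)"])
    show "ext_class P (pair (Base P) f g) \<in> Hom (ext_category P) Y (Prod (Base P) A B) \<and>
        ?p \<cdot>\<^bsub>ext_category P\<^esub> ext_class P (pair (Base P) f g) = \<phi> \<and>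
        ?q \<cdot>\<^bsub>ext_category P\<^esub> ext_class P (pair (Base P) f g) = \<psi>"
      by (simp add: ext_class_in_Hom[OF fg] ext_class_Comp[OF fg p] ext_class_Comp[OF fg q]
          base.Pr1_pair[OF f g] base.Pr2_pair[OF f g] \<phi> \<psi>)
    fix \<chi>
    assume \<chi>: "\<chi> \<in> Hom (ext_category P) Y (Prod (Base P) A B) \<and>
      ?p \<cdot>\<^bsub>ext_category P\<^esub> \<chi> = \<phi> \<and> ?q \<cdot>\<^bsub>ext_category P\<^esub> \<chi> = \<psi>"
    then obtain h where h: "h \<in> Hom (Base P) Y (Prod (Base P) A B)" and \<chi>h: "\<chi> = ext_class P h"
      unfolding Hom_ext_category by blast
    note ph = base.Comp_in_Hom[OF h p] and qh = base.Comp_in_Hom[OF h q]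
    have "internally_equal P (Pr1 (Base P) A B \<cdot>\<^bsub>Base P\<^esub> h) f"
      "internally_equal P (Pr2 (Base P) A B \<cdot>\<^bsub>Base P\<^esub> h) g"
      using \<chi> by (simp_all add: \<chi>h ext_class_Comp[OF h p] ext_class_Comp[OF h q] \<phi> \<psi>
          ext_class_eq_iff[OF ph f] ext_class_eq_iff[OF qh g])
    then have "internally_equal P h (pair (Base P) f g)"
      using internally_equal_pair[OF ph f qh g] by (simp add: base.pair_eta[OF h A B])
    then show "\<chi> = ext_class P (pair (Base P) f g)"
      by (simp add: \<chi>h ext_class_eq_iff[OF h fg])
  qed
qed

lemma category_with_products_ext_category: "category_with_products (ext_category P)"
  by (intro category_with_products.intro category_ext_category category_with_products_axioms.intro)
    (simp add: is_product_ext_category)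

lemma pair_ext_category:
  assumes f: "f \<in> Hom (Base P) Y A" and g: "g \<in> Hom (Base P) Y B"
  shows "pair (ext_category P) (ext_class P f) (ext_class P g) = ext_class P (pair (Base P) f g)"
proof -
  interpret ext: category_with_products "ext_category P"
    by (rule category_with_products_ext_category)
  note A = base.Hom_Obj(2)[OF f] and B = base.Hom_Obj(2)[OF g]
  note fg = base.pair_in_Hom[OF f g]
  note p = base.Pr_in_Hom(1)[OF A B] and q = base.Pr_in_Hom(2)[OF A B]
  show ?thesis
    by (rule ext.pair_eqI[where Y = Y and A = A and B = B])
      (simp_all add: ext_class_in_Hom[OF fg] A B ext_class_Comp[OF fg p] ext_class_Comp[OF fg q]
        base.Pr1_pair[OF f g] base.Pr2_pair[OF f g])
qed

lemma diag_ext_category: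
  "A \<in> Obj (Base P) \<Longrightarrow> diag (ext_category P) A = ext_class P (diag (Base P) A)"
  by (simp add: diag_def pair_ext_category[OF base.Ide_in_Hom base.Ide_in_Hom])

lemma inf_semilattice_doctrine_ext_collapse: "inf_semilattice_doctrine (ext_collapse P)"
proof (rule inf_semilattice_doctrine.intro)
  show "category_with_products (Base (ext_collapse P))"
    by (simp add: category_with_products_ext_category)
  show "inf_semilattice (Fib (ext_collapse P) A)" if "A \<in> Obj (Base (ext_collapse P))" for A
    using that by (simp add: Fib_semilattice)
  show "inf_semilattice_hom (Fib (ext_collapse P) B) (Fib (ext_collapse P) A) (Pull (ext_collapse P) \<phi>)"
    if "\<phi> \<in> Hom (Base (ext_collapse P)) A B" for \<phi> A B
    using Pull_hom[OF rep_in_Hom(1)] that by (simp add: ext_collapse_def)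
  show "Pull (ext_collapse P) (Ide (Base (ext_collapse P)) A) \<alpha> = \<alpha>"
    if "A \<in> Obj (Base (ext_collapse P))" "\<alpha> \<in> carrier (Fib (ext_collapse P) A)" for A \<alpha>
    using that by (simp add: Pull_rep_ext_class[OF base.Ide_in_Hom] Pull_Ide)
next
  fix \<phi> \<psi> \<alpha> A B D
  assume "\<phi> \<in> Hom (Base (ext_collapse P)) A B" "\<psi> \<in> Hom (Base (ext_collapse P)) B D"
    and "\<alpha> \<in> carrier (Fib (ext_collapse P) D)"
  then obtain f g where f: "f \<in> Hom (Base P) A B" "\<phi> = ext_class P f"
    and g: "g \<in> Hom (Base P) B D" "\<psi> = ext_class P g" and \<alpha>: "\<alpha> \<in> carrier (Fib P D)"
    by (auto simp: Hom_ext_category)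
  show "Pull (ext_collapse P) (\<psi> \<cdot>\<^bsub>Base (ext_collapse P)\<^esub> \<phi>) \<alpha> =
      Pull (ext_collapse P) \<phi> (Pull (ext_collapse P) \<psi> \<alpha>)"
    by (simp add: f(2) g(2) ext_class_Comp[OF f(1) g(1)]
        Pull_rep_ext_class[OF base.Comp_in_Hom[OF f(1) g(1)] \<alpha>] Pull_rep_ext_class[OF g(1) \<alpha>]
        Pull_rep_ext_class[OF f(1) Pull_closed[OF g(1) \<alpha>]] Pull_Comp[OF f(1) g(1) \<alpha>])
qed

text \<open>The fibres are those of \<open>P\<close>, and all structural arrows of the collapse are classes of those
  of \<open>Base P\<close>, hence act on the fibres in the same way: the adjunctions to be checked are
  literally those of \<open>P\<close>.\<close>

lemma fibred_equality_ext_collapse: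
  assumes A: "A \<in> Obj (Base P)"
  shows "fibred_equality (ext_collapse P) A (delta P A)"
proof -
  interpret ext: inf_semilattice_doctrine "ext_collapse P"
    by (rule inf_semilattice_doctrine_ext_collapse)
  have A': "A \<in> Obj (Base (ext_collapse P))"
    using A by simp
  note d = delta_closed[OF A]
  note eq = delta_fibred_equality[OF A, unfolded fibred_equality_iff[OF A]]
  have ternary:
    "Pull (ext_collapse P) (pair (ext_category P) (Pr3_1 (ext_category P) X A A)
        (Pr3_2 (ext_category P) X A A)) \<alpha> =
      Pull P (pair (Base P) (Pr3_1 (Base P) X A A) (Pr3_2 (Base P) X A A)) \<alpha>" (is ?th1)
    "Pull (ext_collapse P) (pair (ext_category P) (Pr3_2 (ext_category P) X A A)
        (Pr3_3 (ext_category P) X A A)) (delta P A) =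
      Pull P (pair (Base P) (Pr3_2 (Base P) X A A) (Pr3_3 (Base P) X A A)) (delta P A)" (is ?th2)
    "Pull (ext_collapse P) (triple (ext_category P) (Pr1 (ext_category P) X A)
        (Pr2 (ext_category P) X A) (Pr2 (ext_category P) X A)) \<beta> =
      Pull P (triple (Base P) (Pr1 (Base P) X A) (Pr2 (Base P) X A) (Pr2 (Base P) X A)) \<beta>" (is ?th3)
    if X: "X \<in> Obj (Base P)" and \<alpha>: "\<alpha> \<in> carrier (Fib P (Prod (Base P) X A))"
      and \<beta>: "\<beta> \<in> carrier (Fib P (Prod3 (Base P) X A A))" for X \<alpha> \<beta>
  proof -
    note XA = base.Prod_in_Obj[OF X A]
    note pr = base.Pr_in_Hom[OF X A] and p = base.Pr_in_Hom[OF XA A]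
    note q = Pr3_in_Hom[OF X A A]
    have pr3: "Pr3_1 (ext_category P) X A A = ext_class P (Pr3_1 (Base P) X A A)"
      "Pr3_2 (ext_category P) X A A = ext_class P (Pr3_2 (Base P) X A A)"
      "Pr3_3 (ext_category P) X A A = ext_class P (Pr3_3 (Base P) X A A)"
      by (simp_all add: Pr3_1_def Pr3_2_def Pr3_3_def ext_class_Comp[OF p(1) pr(1)]
          ext_class_Comp[OF p(1) pr(2)])
    have e: "triple (ext_category P) (Pr1 (ext_category P) X A)
        (Pr2 (ext_category P) X A) (Pr2 (ext_category P) X A) =
      ext_class P (triple (Base P) (Pr1 (Base P) X A) (Pr2 (Base P) X A) (Pr2 (Base P) X A))"
      by (simp add: triple_def pair_ext_category[OF pr]
          pair_ext_category[OF base.pair_in_Hom[OF pr] pr(2)])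
    show ?th1 ?th2
      by (simp_all add: pr3 pair_ext_category[OF q(1,2)] pair_ext_category[OF q(2,3)]
          Pull_rep_ext_class[OF base.pair_in_Hom[OF q(1,2)] \<alpha>]
          Pull_rep_ext_class[OF base.pair_in_Hom[OF q(2,3)] d])
    show ?th3
      by (simp add: e[simplified] Pull_rep_ext_class[OF Pr3_triple(1)[OF pr pr(2)] \<beta>])
  qed
  have Prod3: "Prod3 (ext_category P) X B D = Prod3 (Base P) X B D" for X B D
    by (simp add: Prod3_def)
  show ?thesis
    unfolding ext.fibred_equality_iff[OF A']
    using eq ternary
    by (simp add: Prod3 diag_ext_category[OF A] Pull_rep_ext_class[OF base.diag_in_Hom[OF A]]
        Pull_rep_ext_class[OF base.Pr_in_Hom(1)[OF A A]])
qed

lemma elementary_doctrine_ext_collapse: "elementary_doctrine (ext_collapse P)"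
  using inf_semilattice_doctrine_ext_collapse fibred_equality_ext_collapse
  by (auto simp: elementary_doctrine_def elementary_doctrine_axioms_def)

lemma delta_ext_collapse: "A \<in> Obj (Base P) \<Longrightarrow> delta (ext_collapse P) A = delta P A"
  by (intro inf_semilattice_doctrine.delta_eqI inf_semilattice_doctrine_ext_collapse
      fibred_equality_ext_collapse) simp_all

text \<open>The diagonal is a comprehension of \<open>\<delta>\<^sub>A\<close>: if \<open>\<delta>\<^sub>A\<close> becomes true along \<open>\<langle>f\<^sub>1, f\<^sub>2\<rangle>\<close>, then \<open>f\<^sub>1\<close>
  and \<open>f\<^sub>2\<close> are internally equal, so \<open>[\<langle>f\<^sub>1, f\<^sub>2\<rangle>]\<close> is the diagonal composed with \<open>[f\<^sub>1]\<close>.\<close>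

lemma comprehensive_diagonals_ext_collapse: "comprehensive_diagonals (ext_collapse P)"
  unfolding comprehensive_diagonals_def
proof
  fix A assume "A \<in> Obj (Base (ext_collapse P))"
  then have A: "A \<in> Obj (Base P)" by simp
  interpret ext: category_with_products "ext_category P"
    by (rule category_with_products_ext_category)
  note AA = base.Prod_in_Obj[OF A A] and d = delta_closed[OF A]
    and D = base.diag_in_Hom[OF A] and pr = base.Pr_in_Hom[OF A A]
  have D': "diag (ext_category P) A \<in> Hom (ext_category P) A (Prod (Base P) A A)"
    using ext.diag_in_Hom[of A] A by simp
  have "is_comprehension (ext_collapse P) (Prod (Base P) A A) (delta P A) A (diag (ext_category P) A)"
    unfolding is_comprehension_def
  proof (intro conjI allI ballI impI)
    show "diag (ext_category P) A \<in> Hom (Base (ext_collapse P)) A (Prod (Base P) A A)"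
      using D' by simp
    show "Pull (ext_collapse P) (diag (ext_category P) A) (delta P A) = \<top>\<^bsub>Fib (ext_collapse P) A\<^esub>"
      by (simp add: diag_ext_category[OF A] Pull_rep_ext_class[OF D d] Pull_diag_delta[OF A])
    fix W \<phi>
    assume \<phi>: "\<phi> \<in> Hom (Base (ext_collapse P)) W (Prod (Base P) A A)"
      and top: "Pull (ext_collapse P) \<phi> (delta P A) = \<top>\<^bsub>Fib (ext_collapse P) W\<^esub>"
    then obtain f where f: "f \<in> Hom (Base P) W (Prod (Base P) A A)" and \<phi>f: "\<phi> = ext_class P f"
      by (auto simp: Hom_ext_category)
    let ?f1 = "Pr1 (Base P) A A \<cdot>\<^bsub>Base P\<^esub> f" and ?f2 = "Pr2 (Base P) A A \<cdot>\<^bsub>Base P\<^esub> f"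
    note f1 = base.Comp_in_Hom[OF f pr(1)] and f2 = base.Comp_in_Hom[OF f pr(2)]
    have "internally_equal P ?f1 ?f2"
      using top by (simp add: internally_equal_iff[OF f1] base.pair_eta[OF f A A] \<phi>f
          Pull_rep_ext_class[OF f d])
    then have eq: "ext_class P ?f1 = ext_class P ?f2"
      by (simp add: ext_class_eq_iff[OF f1 f2])
    have "diag (ext_category P) A \<cdot>\<^bsub>ext_category P\<^esub> ext_class P ?f1 = pair (ext_category P) (ext_class P ?f1) (ext_class P ?f2)"
      using ext.diag_Comp[OF ext_class_in_Hom[OF f1]] eq by simp
    also have "\<dots> = \<phi>"
      by (simp add: pair_ext_category[OF f1 f2] base.pair_eta[OF f A A] \<phi>f)
    finally have factor: "\<phi> = diag (ext_category P) A \<cdot>\<^bsub>ext_category P\<^esub> ext_class P ?f1" ..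
    have "\<gamma> = ext_class P ?f1"
      if \<gamma>: "\<gamma> \<in> Hom (ext_category P) W A" "\<phi> = diag (ext_category P) A \<cdot>\<^bsub>ext_category P\<^esub> \<gamma>" for \<gamma>
    proof -
      have "pair (ext_category P) \<gamma> \<gamma> = pair (ext_category P) (ext_class P ?f1) (ext_class P ?f1)"
        using \<gamma> factor ext.diag_Comp ext_class_in_Hom[OF f1] by metis
      then show ?thesis
        using ext.Pr1_pair[OF \<gamma>(1) \<gamma>(1)] ext.Pr1_pair[OF ext_class_in_Hom[OF f1] ext_class_in_Hom[OF f1]]
        by metis
    qed
    then show "\<exists>!\<gamma>. \<gamma> \<in> Hom (Base (ext_collapse P)) W A \<and>
        \<phi> = diag (ext_category P) A \<cdot>\<^bsub>Base (ext_collapse P)\<^esub> \<gamma>"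
      using factor ext_class_in_Hom[OF f1] by (intro ex1I[of _ "ext_class P ?f1"]) auto
  qed
  then show "\<exists>\<alpha> \<in> carrier (Fib (ext_collapse P) (Prod (Base (ext_collapse P)) A A)).
      is_comprehension (ext_collapse P) (Prod (Base (ext_collapse P)) A A) \<alpha> A
        (diag (Base (ext_collapse P)) A)"
    using d by auto
qed

theorem CED_ext_collapse: "CED (ext_collapse P)"
  unfolding CED_def
  using elementary_doctrine_ext_collapse comprehensive_diagonals_ext_collapse by simp

lemma is_functor_quotient:
  "is_functor (Base P) (ext_category P)
    \<lparr>Obj_map = (\<lambda>A \<in> Obj (Base P). A), Arr_map = (\<lambda>f \<in> Arr (Base P). ext_class P f)\<rparr>"
  unfolding is_functor_def
  using base.category_axioms category_ext_category
  by (auto simp: Hom_Arr base.Hom_Obj ext_class_in_Hom ext_class_Comp base.Comp_in_Hom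
      intro: base.Comp_in_Hom[THEN Hom_Arr] base.Ide_in_Hom[THEN Hom_Arr]
        ext_class_in_Hom[OF HomI, THEN Hom_Arr] dest: base.Hom_Obj)

lemma is_one_arrow_collapse_arrow: "is_one_arrow P (ext_collapse P) (collapse_arrow P)"
proof -
  let ?K = "\<lparr>Obj_map = (\<lambda>A \<in> Obj (Base P). A), Arr_map = (\<lambda>f \<in> Arr (Base P). ext_class P f)\<rparr>"
  have prods: "preserves_products (Base P) (ext_category P) ?K"
    unfolding preserves_products_def
    by (auto simp: is_product_ext_category base.Prod_in_Obj base.Pr_in_Hom[THEN Hom_Arr])
  have natural: "(\<lambda>A \<in> Obj (Base P). \<lambda>\<alpha> \<in> carrier (Fib P A). \<alpha>) A (Pull P f \<alpha>) =
      Pull (ext_collapse P) (Arr_map ?K f)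
        ((\<lambda>A \<in> Obj (Base P). \<lambda>\<alpha> \<in> carrier (Fib P A). \<alpha>) B \<alpha>)"
    if f: "f \<in> Hom (Base P) A B" and \<alpha>: "\<alpha> \<in> carrier (Fib P B)" for A B f \<alpha>
    by (simp add: base.Hom_Obj[OF f] Hom_Arr[OF f] \<alpha> Pull_closed[OF f \<alpha>] Pull_rep_ext_class[OF f \<alpha>])
  have hom: "inf_semilattice_hom (Fib P A) (Fib P A) (\<lambda>\<alpha> \<in> carrier (Fib P A). \<alpha>)"
    if A: "A \<in> Obj (Base P)" for A
    using meet_closed[OF A] top_closed[OF A] by (simp add: inf_semilattice_hom_def)
  have delta: "delta P A = Pull (ext_collapse P)
      (pair (ext_category P) (Arr_map ?K (Pr1 (Base P) A A)) (Arr_map ?K (Pr2 (Base P) A A)))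
      (delta (ext_collapse P) A)"
    if A: "A \<in> Obj (Base P)" for A
  proof -
    note AA = base.Prod_in_Obj[OF A A] and pr = base.Pr_in_Hom[OF A A]
    have I: "pair (Base P) (Pr1 (Base P) A A) (Pr2 (Base P) A A) = Ide (Base P) (Prod (Base P) A A)"
      using base.pair_eta[OF base.Ide_in_Hom[OF AA] A A]
      by (simp add: base.Comp_Ide[OF pr(1)] base.Comp_Ide[OF pr(2)])
    show ?thesis
      by (simp add: Hom_Arr[OF pr(1)] Hom_Arr[OF pr(2)] pair_ext_category[OF pr] I
          delta_ext_collapse[OF A] Pull_rep_ext_class[OF base.Ide_in_Hom[OF AA] delta_closed[OF A]]
          Pull_Ide[OF AA delta_closed[OF A]])
  qed
  show ?thesis
    unfolding is_one_arrow_def collapse_arrow_def prod.case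
  proof (intro conjI allI ballI)
    show "(\<lambda>A \<in> Obj (Base P). \<lambda>\<alpha> \<in> carrier (Fib P A). \<alpha>) \<in>
        (\<Pi>\<^sub>E A \<in> Obj (Base P). carrier (Fib P A) \<rightarrow>\<^sub>E carrier (Fib (ext_collapse P) (Obj_map ?K A)))"
      by auto
  next
    fix A assume A: "A \<in> Obj (Base P)"
    show "inf_semilattice_hom (Fib P A) (Fib (ext_collapse P) (Obj_map ?K A))
        ((\<lambda>A \<in> Obj (Base P). \<lambda>\<alpha> \<in> carrier (Fib P A). \<alpha>) A)"
      using hom[OF A] A by simp
    show "(\<lambda>A \<in> Obj (Base P). \<lambda>\<alpha> \<in> carrier (Fib P A). \<alpha>) (Prod (Base P) A A) (delta P A) =
        Pull (ext_collapse P) (pair (Base (ext_collapse P)) (Arr_map ?K (Pr1 (Base P) A A))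
          (Arr_map ?K (Pr2 (Base P) A A))) (delta (ext_collapse P) (Obj_map ?K A))"
      using delta[OF A, symmetric] A
      by (simp only: base.Prod_in_Obj delta_closed restrict_apply' ext_collapse_simps
          cfunctor.select_convs)
  qed (use is_functor_quotient prods natural in \<open>simp_all only: ext_collapse_simps\<close>)
qed

end


section \<open>Hom-categories of elementary doctrines\<close>

lemma is_one_arrowD:
  assumes "is_one_arrow P R m"
  shows one_arrow_functor: "is_functor (Base P) (Base R) (fst m)"
    and one_arrow_fibre_maps: "snd m \<in> (\<Pi>\<^sub>E A \<in> Obj (Base P). carrier (Fib P A) \<rightarrow>\<^sub>E
        carrier (Fib R (Obj_map (fst m) A)))"
    and one_arrow_natural: "\<lbrakk>f \<in> Hom (Base P) A B; \<alpha> \<in> carrier (Fib P B)\<rbrakk> \<Longrightarrow>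
        snd m A (Pull P f \<alpha>) = Pull R (Arr_map (fst m) f) (snd m B \<alpha>)"
    and one_arrow_meets: "A \<in> Obj (Base P) \<Longrightarrow>
        inf_semilattice_hom (Fib P A) (Fib R (Obj_map (fst m) A)) (snd m A)"
    and one_arrow_delta: "A \<in> Obj (Base P) \<Longrightarrow>
        snd m (Prod (Base P) A A) (delta P A) =
          Pull R (pair (Base R) (Arr_map (fst m) (Pr1 (Base P) A A))
            (Arr_map (fst m) (Pr2 (Base P) A A))) (delta R (Obj_map (fst m) A))"
  using assms unfolding is_one_arrow_def by (auto split: prod.splits)

lemma is_functorD:
  assumes "is_functor C D F"
  shows functor_Obj: "A \<in> Obj C \<Longrightarrow> Obj_map F A \<in> Obj D"
    and functor_Hom: "f \<in> Hom C A B \<Longrightarrow> Arr_map F f \<in> Hom D (Obj_map F A) (Obj_map F B)"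
    and functor_Comp: "\<lbrakk>f \<in> Hom C A B; g \<in> Hom C B E\<rbrakk> \<Longrightarrow>
        Arr_map F (g \<cdot>\<^bsub>C\<^esub> f) = Arr_map F g \<cdot>\<^bsub>D\<^esub> Arr_map F f"
    and functor_Obj_extensional: "Obj_map F \<in> extensional (Obj C)"
    and functor_Arr_extensional: "Arr_map F \<in> extensional (Arr C)"
  using assms unfolding is_functor_def by (auto simp: PiE_def)

lemma one_arrow_closed:
  "\<lbrakk>is_one_arrow P R m; A \<in> Obj (Base P); \<alpha> \<in> carrier (Fib P A)\<rbrakk> \<Longrightarrow>
    snd m A \<alpha> \<in> carrier (Fib R (Obj_map (fst m) A))"
  using one_arrow_fibre_maps by blast

lemma is_two_arrowD:
  assumes "is_two_arrow P R \<theta>"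
  shows two_arrow_Src: "is_one_arrow P R (Src \<theta>)"
    and two_arrow_Tgt: "is_one_arrow P R (Tgt \<theta>)"
    and two_arrow_Cpt: "A \<in> Obj (Base P) \<Longrightarrow>
      Cpt \<theta> A \<in> Hom (Base R) (Obj_map (fst (Src \<theta>)) A) (Obj_map (fst (Tgt \<theta>)) A)"
    and two_arrow_extensional: "Cpt \<theta> \<in> extensional (Obj (Base P))"
    and two_arrow_natural: "f \<in> Hom (Base P) A B \<Longrightarrow>
      Cpt \<theta> B \<cdot>\<^bsub>Base R\<^esub> Arr_map (fst (Src \<theta>)) f = Arr_map (fst (Tgt \<theta>)) f \<cdot>\<^bsub>Base R\<^esub> Cpt \<theta> A"
    and two_arrow_le: "\<lbrakk>A \<in> Obj (Base P); \<alpha> \<in> carrier (Fib P A)\<rbrakk> \<Longrightarrow>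
      snd (Src \<theta>) A \<alpha> \<sqsubseteq>\<^bsub>Fib R (Obj_map (fst (Src \<theta>)) A)\<^esub>
        Pull R (Cpt \<theta> A) (snd (Tgt \<theta>) A \<alpha>)"
  using assms unfolding is_two_arrow_def natural_transformation_def by (auto simp: PiE_def)

lemma ED_hom_simps [simp]:
  "Obj (ED_hom P R) = {m. is_one_arrow P R m}"
  "Arr (ED_hom P R) = {\<theta>. is_two_arrow P R \<theta>}"
  "Dom (ED_hom P R) = Src"
  "Cod (ED_hom P R) = Tgt"
  "Ide (ED_hom P R) m = \<lparr>Src = m, Tgt = m,
    Cpt = (\<lambda>A \<in> Obj (Base P). Ide (Base R) (Obj_map (fst m) A))\<rparr>"
  "\<eta> \<cdot>\<^bsub>ED_hom P R\<^esub> \<theta> = \<lparr>Src = Src \<theta>, Tgt = Tgt \<eta>,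
    Cpt = (\<lambda>A \<in> Obj (Base P). Cpt \<eta> A \<cdot>\<^bsub>Base R\<^esub> Cpt \<theta> A)\<rparr>"
  by (simp_all add: ED_hom_def)

lemma Hom_ED_hom: "\<theta> \<in> Hom (ED_hom P R) m n \<longleftrightarrow> is_two_arrow P R \<theta> \<and> Src \<theta> = m \<and> Tgt \<theta> = n"
  by (simp add: Hom_def)

lemma is_two_arrow_Ide:
  assumes P: "inf_semilattice_doctrine P" and R: "inf_semilattice_doctrine R"
    and m: "is_one_arrow P R m"
  shows "is_two_arrow P R (Ide (ED_hom P R) m)"
proof -
  interpret P: inf_semilattice_doctrine P by fact
  interpret R: inf_semilattice_doctrine R by fact
  note F = one_arrow_functor[OF m]
  have "natural_transformation (Base P) (Base R) (fst m) (fst m)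
      (\<lambda>A \<in> Obj (Base P). Ide (Base R) (Obj_map (fst m) A))"
    unfolding natural_transformation_def
    by (auto simp: P.base.Hom_Obj functor_Obj[OF F] R.base.Ide_in_Hom
        R.base.Ide_Comp[OF functor_Hom[OF F]] R.base.Comp_Ide[OF functor_Hom[OF F]])
  then show ?thesis
    using m by (auto simp: is_two_arrow_def R.Pull_Ide functor_Obj[OF F] one_arrow_closed R.fib_refl)
qed

lemma is_two_arrow_Comp:
  assumes P: "inf_semilattice_doctrine P" and R: "inf_semilattice_doctrine R"
    and \<theta>: "is_two_arrow P R \<theta>" and \<eta>: "is_two_arrow P R \<eta>" and eq: "Tgt \<theta> = Src \<eta>"
  shows "is_two_arrow P R (\<eta> \<cdot>\<^bsub>ED_hom P R\<^esub> \<theta>)"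
proof -
  interpret P: inf_semilattice_doctrine P by fact
  interpret R: inf_semilattice_doctrine R by fact
  note F = one_arrow_functor[OF two_arrow_Src[OF \<theta>]] and G = one_arrow_functor[OF two_arrow_Src[OF \<eta>]]
    and H = one_arrow_functor[OF two_arrow_Tgt[OF \<eta>]]
  note c = two_arrow_Cpt[OF \<theta>, unfolded eq] and d = two_arrow_Cpt[OF \<eta>]
  have "(Cpt \<eta> B \<cdot>\<^bsub>Base R\<^esub> Cpt \<theta> B) \<cdot>\<^bsub>Base R\<^esub> Arr_map (fst (Src \<theta>)) f =
      Arr_map (fst (Tgt \<eta>)) f \<cdot>\<^bsub>Base R\<^esub> (Cpt \<eta> A \<cdot>\<^bsub>Base R\<^esub> Cpt \<theta> A)"
    if f: "f \<in> Hom (Base P) A B" for f A B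
  proof -
    note A = P.base.Hom_Obj(1)[OF f] and B = P.base.Hom_Obj(2)[OF f]
    show ?thesis
      by (simp add: R.base.Comp_assoc[OF functor_Hom[OF F f] c[OF B] d[OF B]]
          two_arrow_natural[OF \<theta> f, unfolded eq]
          R.base.Comp_assoc[OF c[OF A] functor_Hom[OF G f] d[OF B], symmetric]
          two_arrow_natural[OF \<eta> f] R.base.Comp_assoc[OF c[OF A] d[OF A] functor_Hom[OF H f]])
  qed
  then have "natural_transformation (Base P) (Base R) (fst (Src \<theta>)) (fst (Tgt \<eta>))
      (\<lambda>A \<in> Obj (Base P). Cpt \<eta> A \<cdot>\<^bsub>Base R\<^esub> Cpt \<theta> A)"
    unfolding natural_transformation_def
    by (auto simp: P.base.Hom_Obj intro: R.base.Comp_in_Hom[OF c d])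
  moreover have "snd (Src \<theta>) A \<alpha> \<sqsubseteq>\<^bsub>Fib R (Obj_map (fst (Src \<theta>)) A)\<^esub>
      Pull R (Cpt \<eta> A \<cdot>\<^bsub>Base R\<^esub> Cpt \<theta> A) (snd (Tgt \<eta>) A \<alpha>)"
    if A: "A \<in> Obj (Base P)" and \<alpha>: "\<alpha> \<in> carrier (Fib P A)" for A \<alpha>
  proof -
    note ca = one_arrow_closed[OF two_arrow_Src[OF \<theta>] A \<alpha>]
      and cb = one_arrow_closed[OF two_arrow_Src[OF \<eta>] A \<alpha>]
      and cc = one_arrow_closed[OF two_arrow_Tgt[OF \<eta>] A \<alpha>]
    note pc = R.Pull_closed[OF d[OF A] cc]
    have "snd (Src \<theta>) A \<alpha> \<sqsubseteq>\<^bsub>Fib R (Obj_map (fst (Src \<theta>)) A)\<^esub>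
        Pull R (Cpt \<theta> A) (Pull R (Cpt \<eta> A) (snd (Tgt \<eta>) A \<alpha>))"
      using R.fib_trans[OF functor_Obj[OF F A] two_arrow_le[OF \<theta> A \<alpha>, unfolded eq]
          R.Pull_mono[OF c[OF A] cb pc two_arrow_le[OF \<eta> A \<alpha>]] ca
          R.Pull_closed[OF c[OF A] cb] R.Pull_closed[OF c[OF A] pc]] .
    then show ?thesis
      by (simp add: R.Pull_Comp[OF c[OF A] d[OF A] cc])
  qed
  ultimately show ?thesis
    using two_arrow_Src[OF \<theta>] two_arrow_Tgt[OF \<eta>] by (simp add: is_two_arrow_def)
qed

lemma two_arrow_eqI:
  fixes \<theta> \<eta> :: "('m, 'o, 'a) two_arrow"
  assumes "Src \<theta> = Src \<eta>" "Tgt \<theta> = Tgt \<eta>"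
    and "Cpt \<theta> \<in> extensional S" "Cpt \<eta> \<in> extensional S" "\<And>A. A \<in> S \<Longrightarrow> Cpt \<theta> A = Cpt \<eta> A"
  shows "\<theta> = \<eta>"
  using assms extensionalityI[OF assms(3-5)] by (cases \<theta>, cases \<eta>) simp

lemma category_ED_hom:
  assumes P: "inf_semilattice_doctrine P" and R: "inf_semilattice_doctrine R"
  shows "category (ED_hom P R)"
proof -
  interpret P: inf_semilattice_doctrine P by fact
  interpret R: inf_semilattice_doctrine R by fact
  show ?thesis
  proof
    show "Dom (ED_hom P R) \<theta> \<in> Obj (ED_hom P R)" "Cod (ED_hom P R) \<theta> \<in> Obj (ED_hom P R)"
      if "\<theta> \<in> Arr (ED_hom P R)" for \<theta>
      using that by (simp_all add: two_arrow_Src two_arrow_Tgt)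
    show "Ide (ED_hom P R) m \<in> Hom (ED_hom P R) m m" if "m \<in> Obj (ED_hom P R)" for m
      using is_two_arrow_Ide[OF P R] that by (simp add: Hom_ED_hom)
    show "\<eta> \<cdot>\<^bsub>ED_hom P R\<^esub> \<theta> \<in> Hom (ED_hom P R) m l"
      if "\<theta> \<in> Hom (ED_hom P R) m n" "\<eta> \<in> Hom (ED_hom P R) n l" for \<theta> \<eta> m n l
      using is_two_arrow_Comp[OF P R, of \<theta> \<eta>] that by (simp add: Hom_ED_hom)
  next
    fix \<theta> m n assume "\<theta> \<in> Hom (ED_hom P R) m n"
    then have \<theta>: "is_two_arrow P R \<theta>" and m: "Src \<theta> = m" and n: "Tgt \<theta> = n"
      by (simp_all add: Hom_ED_hom)
    show "\<theta> \<cdot>\<^bsub>ED_hom P R\<^esub> Ide (ED_hom P R) m = \<theta>"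
      by (rule two_arrow_eqI[where S = "Obj (Base P)"])
        (simp_all add: m two_arrow_extensional[OF \<theta>]
          R.base.Comp_Ide[OF two_arrow_Cpt[OF \<theta>, unfolded m n]])
    show "Ide (ED_hom P R) n \<cdot>\<^bsub>ED_hom P R\<^esub> \<theta> = \<theta>"
      by (rule two_arrow_eqI[where S = "Obj (Base P)"])
        (simp_all add: n two_arrow_extensional[OF \<theta>]
          R.base.Ide_Comp[OF two_arrow_Cpt[OF \<theta>, unfolded m n]])
  next
    fix \<theta> \<eta> \<zeta> m n l k
    assume "\<theta> \<in> Hom (ED_hom P R) m n" "\<eta> \<in> Hom (ED_hom P R) n l" "\<zeta> \<in> Hom (ED_hom P R) l k"
    then have \<theta>: "is_two_arrow P R \<theta>" "Src \<theta> = m" "Tgt \<theta> = n"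
      and \<eta>: "is_two_arrow P R \<eta>" "Src \<eta> = n" "Tgt \<eta> = l"
      and \<zeta>: "is_two_arrow P R \<zeta>" "Src \<zeta> = l" "Tgt \<zeta> = k"
      by (simp_all add: Hom_ED_hom)
    show "(\<zeta> \<cdot>\<^bsub>ED_hom P R\<^esub> \<eta>) \<cdot>\<^bsub>ED_hom P R\<^esub> \<theta> = \<zeta> \<cdot>\<^bsub>ED_hom P R\<^esub> (\<eta> \<cdot>\<^bsub>ED_hom P R\<^esub> \<theta>)"
      by (rule two_arrow_eqI[where S = "Obj (Base P)"])
        (simp_all add: R.base.Comp_assoc[OF two_arrow_Cpt[OF \<theta>(1), unfolded \<theta>(2,3)]
            two_arrow_Cpt[OF \<eta>(1), unfolded \<eta>(2,3)] two_arrow_Cpt[OF \<zeta>(1), unfolded \<zeta>(2,3)]])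
  qed
qed

section \<open>Factoring through the collapse\<close>

text \<open>If the diagonal is a comprehension of \<open>\<alpha>\<close>, then \<open>\<alpha>\<close> is reflexive and so lies above \<open>\<delta>\<^sub>A\<close>. Internal
  equality of \<open>f\<close> and \<open>g\<close> therefore makes \<open>\<alpha>\<close> true along \<open>\<langle>f, g\<rangle>\<close>, and \<open>\<langle>f, g\<rangle>\<close> factors through
  the diagonal.\<close>

lemma (in elementary_doctrine) internally_equal_imp_eq:
  assumes diags: "comprehensive_diagonals P"
    and f: "f \<in> Hom (Base P) Y A" and g: "g \<in> Hom (Base P) Y A" and fg: "internally_equal P f g"
  shows "f = g"
proof -
  note A = base.Hom_Obj(2)[OF f] and Y = base.Hom_Obj(1)[OF f]
  note D = base.diag_in_Hom[OF A] and pfg = base.pair_in_Hom[OF f g] and d = delta_closed[OF A]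
  obtain \<alpha> where \<alpha>: "\<alpha> \<in> carrier (Fib P (Prod (Base P) A A))"
    and comp: "is_comprehension P (Prod (Base P) A A) \<alpha> A (diag (Base P) A)"
    using diags A by (auto simp: comprehensive_diagonals_def)
  have "fib_le (Prod (Base P) A A) (delta P A) \<alpha>"
    using comp by (simp add: is_comprehension_def delta_le_iff[OF A \<alpha>])
  from Pull_mono[OF pfg d \<alpha> this] have "Pull P (pair (Base P) f g) \<alpha> = \<top>\<^bsub>Fib P Y\<^esub>"
    using fg by (simp add: internally_equal_iff[OF f] top_le_iff[OF Y Pull_closed[OF pfg \<alpha>]])
  then obtain k where k: "k \<in> Hom (Base P) Y A"
    and eq: "pair (Base P) f g = diag (Base P) A \<cdot>\<^bsub>Base P\<^esub> k"
    using comp pfg unfolding is_comprehension_def by blast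
  have "pair (Base P) f g = pair (Base P) k k"
    using eq base.diag_Comp[OF k] by simp
  then show ?thesis
    using base.Pr1_pair[OF f g] base.Pr2_pair[OF f g] base.Pr1_pair[OF k k] base.Pr2_pair[OF k k]
    by simp
qed

text \<open>With naturality of \<open>b\<close>, preservation of \<open>\<delta>\<close> by a 1-arrow \<open>(F, b)\<close> turns \<open>b(P\<^bsub>\<langle>f,g\<rangle>\<^esub>(\<delta>)) = \<top>\<close> into
  \<open>R\<^bsub>\<langle>F f, F g\<rangle>\<^esub>(\<delta>) = \<top>\<close>.\<close>

lemma one_arrow_internally_equal:
  assumes P: "elementary_doctrine P" and R: "elementary_doctrine R" and m: "is_one_arrow P R m"
    and f: "f \<in> Hom (Base P) Y A" and g: "g \<in> Hom (Base P) Y A" and fg: "internally_equal P f g"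
  shows "internally_equal R (Arr_map (fst m) f) (Arr_map (fst m) g)"
proof -
  interpret P: elementary_doctrine P by fact
  interpret R: elementary_doctrine R by fact
  let ?F = "Arr_map (fst m)"
  note F = one_arrow_functor[OF m]
  note A = P.base.Hom_Obj(2)[OF f] and Y = P.base.Hom_Obj(1)[OF f]
  note pr = P.base.Pr_in_Hom[OF A A] and pfg = P.base.pair_in_Hom[OF f g]
  note Fpr = functor_Hom[OF F pr(1)] functor_Hom[OF F pr(2)] and Fpfg = functor_Hom[OF F pfg]
  note Fprs = R.base.pair_in_Hom[OF Fpr]
  have "\<top>\<^bsub>Fib R (Obj_map (fst m) Y)\<^esub> = snd m Y (Pull P (pair (Base P) f g) (delta P A))"
    using fg one_arrow_meets[OF m Y] by (simp add: internally_equal_iff[OF f] inf_semilattice_hom_def)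
  also have "\<dots> = Pull R (?F (pair (Base P) f g)) (Pull R (pair (Base R) (?F (Pr1 (Base P) A A))
      (?F (Pr2 (Base P) A A))) (delta R (Obj_map (fst m) A)))"
    using one_arrow_natural[OF m pfg P.delta_closed[OF A]] one_arrow_delta[OF m A] by simp
  also have "\<dots> = Pull R (pair (Base R) (?F f) (?F g)) (delta R (Obj_map (fst m) A))"
    by (simp add: R.Pull_Comp[OF Fpfg Fprs R.delta_closed[OF functor_Obj[OF F A]], symmetric]
        R.base.pair_Comp[OF Fpr Fpfg] functor_Comp[OF F pfg pr(1), symmetric]
        functor_Comp[OF F pfg pr(2), symmetric] P.base.Pr1_pair[OF f g] P.base.Pr2_pair[OF f g])
  finally show ?thesis
    by (simp add: internally_equal_iff[OF functor_Hom[OF F f]])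
qed

text \<open>\<open>G \<circ> K\<close>, spelled out without the restriction of \<open>Obj_map G\<close> that \<open>comp_functor\<close> introduces:
  for a functor out of the collapse that restriction changes nothing, and without it only the
  action on arrows differs from that of \<open>G\<close>.\<close>

definition along_quotient ::
    "('o, 'a, 'p) doctrine \<Rightarrow> ('o, 'a set, 'o2, 'a2) cfunctor \<Rightarrow> ('o, 'a, 'o2, 'a2) cfunctor" where
  "along_quotient P G =
    \<lparr>Obj_map = Obj_map G, Arr_map = (\<lambda>f \<in> Arr (Base P). Arr_map G (ext_class P f))\<rparr>"

lemma along_quotient_simps [simp]:
  "Obj_map (along_quotient P G) = Obj_map G"
  "f \<in> Hom (Base P) A B \<Longrightarrow> Arr_map (along_quotient P G) f = Arr_map G (ext_class P f)"
  by (simp_all add: along_quotient_def Hom_Arr)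

context elementary_doctrine
begin

lemma comp_one_arrow_collapse_arrow:
  assumes n: "is_one_arrow (ext_collapse P) Z n"
  shows "comp_one_arrow P n (collapse_arrow P) = (along_quotient P (fst n), snd n)"
proof -
  have "compose (Obj (Base P)) (Obj_map (fst n)) (\<lambda>A \<in> Obj (Base P). A) = Obj_map (fst n)"
    using functor_Obj_extensional[OF one_arrow_functor[OF n]]
    by (intro extensionalityI[of _ "Obj (Base P)"]) (simp_all add: compose_eq)
  moreover have "compose (Arr (Base P)) (Arr_map (fst n)) (\<lambda>f \<in> Arr (Base P). ext_class P f) =
      (\<lambda>f \<in> Arr (Base P). Arr_map (fst n) (ext_class P f))"
    by (auto simp: compose_def)
  moreover have "(\<lambda>A \<in> Obj (Base P). compose (carrier (Fib P A)) (snd n ((\<lambda>A \<in> Obj (Base P). A) A))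
      ((\<lambda>A \<in> Obj (Base P). \<lambda>\<alpha> \<in> carrier (Fib P A). \<alpha>) A)) = snd n"
  proof (rule extensionalityI[of _ "Obj (Base P)"])
    show "snd n \<in> extensional (Obj (Base P))"
      using one_arrow_fibre_maps[OF n] by (simp add: PiE_def)
    fix A assume A: "A \<in> Obj (Base P)"
    have "snd n A \<in> extensional (carrier (Fib P A))"
      using one_arrow_fibre_maps[OF n] A by (auto simp: PiE_def)
    then have "compose (carrier (Fib P A)) (snd n A) (\<lambda>\<alpha> \<in> carrier (Fib P A). \<alpha>) = snd n A"
      by (intro extensionalityI[of _ "carrier (Fib P A)"]) (simp_all add: compose_eq)
    with A show "(\<lambda>A \<in> Obj (Base P). compose (carrier (Fib P A)) (snd n ((\<lambda>A \<in> Obj (Base P). A) A))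
        ((\<lambda>A \<in> Obj (Base P). \<lambda>\<alpha> \<in> carrier (Fib P A). \<alpha>) A)) A = snd n A"
      by simp
  qed simp
  ultimately show ?thesis
    by (simp add: comp_one_arrow_def collapse_arrow_def comp_functor_def along_quotient_def
        split_beta)
qed

lemma is_functor_along_quotient_iff:
  assumes G: "Arr_map G \<in> Arr (ext_category P) \<rightarrow>\<^sub>E Arr D"
  shows "is_functor (Base P) D (along_quotient P G) \<longleftrightarrow> is_functor (ext_category P) D G"
proof -
  have arr: "Arr_map (along_quotient P G) \<in> Arr (Base P) \<rightarrow>\<^sub>E Arr D"
    using G ext_class_in_Hom[OF HomI, THEN Hom_Arr] by (auto simp: along_quotient_def)
  have "Ide (Base P) A \<in> Hom (Base P) A A" if "A \<in> Obj (Base P)" for A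
    using base.Ide_in_Hom that .
  note I = along_quotient_simps(2)[OF this]
  have comp: "(\<forall>A B E. \<forall>f \<in> Hom (Base P) A B. \<forall>g \<in> Hom (Base P) B E.
      Arr_map (along_quotient P G) (g \<cdot>\<^bsub>Base P\<^esub> f) =
        Arr_map (along_quotient P G) g \<cdot>\<^bsub>D\<^esub> Arr_map (along_quotient P G) f) \<longleftrightarrow>
    (\<forall>A B E. \<forall>\<phi> \<in> Hom (ext_category P) A B. \<forall>\<psi> \<in> Hom (ext_category P) B E.
      Arr_map G (\<psi> \<cdot>\<^bsub>ext_category P\<^esub> \<phi>) = Arr_map G \<psi> \<cdot>\<^bsub>D\<^esub> Arr_map G \<phi>)"
    unfolding Hom_ext_category ball_simps
    by (intro all_cong1 ball_cong refl)
      (simp add: ext_class_Comp along_quotient_simps(2)[OF base.Comp_in_Hom])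
  show ?thesis
    unfolding is_functor_def comp
    using arr G base.category_axioms category_ext_category by (simp add: Hom_ext_category I)
qed

lemma preserves_products_along_quotient_iff:
  "preserves_products (Base P) D (along_quotient P G) \<longleftrightarrow> preserves_products (ext_category P) D G"
  unfolding preserves_products_def
  by (simp add: along_quotient_simps(2)[OF base.Pr_in_Hom(1)] along_quotient_simps(2)[OF base.Pr_in_Hom(2)])

text \<open>Each condition on a 1-arrow out of the collapse, applied to classes, is the corresponding
  condition on its composite with \<open>(K, k)\<close>. The equivalence serves in both directions: for
  composition with \<open>(K, k)\<close>, and for factorisation through it.\<close>

lemma is_one_arrow_along_quotient_iff:
  assumes G: "Arr_map G \<in> Arr (ext_category P) \<rightarrow>\<^sub>E Arr (Base Z)"
  shows "is_one_arrow P Z (along_quotient P G, c) \<longleftrightarrow> is_one_arrow (ext_collapse P) Z (G, c)"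
proof -
  have natural: "(\<forall>A B. \<forall>f \<in> Hom (Base P) A B. \<forall>\<alpha> \<in> carrier (Fib P B).
      c A (Pull P f \<alpha>) = Pull Z (Arr_map (along_quotient P G) f) (c B \<alpha>)) \<longleftrightarrow>
    (\<forall>A B. \<forall>\<phi> \<in> Hom (ext_category P) A B. \<forall>\<alpha> \<in> carrier (Fib P B).
      c A (Pull P (rep \<phi>) \<alpha>) = Pull Z (Arr_map G \<phi>) (c B \<alpha>))"
    by (simp add: Hom_ext_category Pull_rep_ext_class)
  show ?thesis
    unfolding is_one_arrow_def prod.case ext_collapse_simps natural
      is_functor_along_quotient_iff[OF G] preserves_products_along_quotient_iff
    by (simp add: delta_ext_collapse along_quotient_simps(2)[OF base.Pr_in_Hom(1)]
        along_quotient_simps(2)[OF base.Pr_in_Hom(2)])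
qed

lemma is_one_arrow_comp_collapse_arrow:
  assumes n: "is_one_arrow (ext_collapse P) Z n"
  shows "is_one_arrow P Z (comp_one_arrow P n (collapse_arrow P))"
proof -
  have "Arr_map (fst n) \<in> Arr (ext_category P) \<rightarrow>\<^sub>E Arr (Base Z)"
    using one_arrow_functor[OF n] by (simp add: is_functor_def)
  from is_one_arrow_along_quotient_iff[OF this, of "snd n"] show ?thesis
    using n by (simp add: comp_one_arrow_collapse_arrow[OF n])
qed

text \<open>A 1-arrow \<open>(F, b)\<close> into a doctrine with comprehensive diagonals sends internally equal arrows to
  equal ones, so \<open>F\<close> is constant on classes and may be evaluated on representatives. The
  factorisation is an equality, not just an isomorphism.\<close>

lemma one_arrow_factors_through_collapse:
  assumes Z: "CED Z" and m: "is_one_arrow P Z m"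
  shows "\<exists>n. is_one_arrow (ext_collapse P) Z n \<and> comp_one_arrow P n (collapse_arrow P) = m"
proof -
  interpret Z: elementary_doctrine Z using Z by (simp add: CED_def)
  note F = one_arrow_functor[OF m]
  let ?G = "\<lparr>Obj_map = Obj_map (fst m),
    Arr_map = (\<lambda>\<phi> \<in> Arr (ext_category P). Arr_map (fst m) (rep \<phi>))\<rparr>"
  have rep: "Arr_map (fst m) (rep (ext_class P f)) = Arr_map (fst m) f"
    if f: "f \<in> Hom (Base P) A B" for f A B
  proof -
    note r = rep_ext_class[OF f]
    have "internally_equal Z (Arr_map (fst m) f) (Arr_map (fst m) (rep (ext_class P f)))"
      by (rule one_arrow_internally_equal[OF elementary_doctrine_axioms Z.elementary_doctrine_axioms
            m f r(1,2)])
    then show ?thesis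
      using Z.internally_equal_imp_eq[OF _ functor_Hom[OF F f] functor_Hom[OF F r(1)]] Z
      by (simp add: CED_def)
  qed
  have G: "Arr_map ?G \<in> Arr (ext_category P) \<rightarrow>\<^sub>E Arr (Base Z)"
    using functor_Hom[OF F rep_in_Hom(1)[OF HomI], THEN Hom_Arr] by auto
  have "Arr_map (along_quotient P ?G) = Arr_map (fst m)"
  proof (rule extensionalityI[of _ "Arr (Base P)"])
    show "Arr_map (along_quotient P ?G) \<in> extensional (Arr (Base P))"
      by (simp add: along_quotient_def)
    show "Arr_map (fst m) \<in> extensional (Arr (Base P))"
      by (rule functor_Arr_extensional[OF F])
    fix f assume "f \<in> Arr (Base P)"
    then have f: "f \<in> Hom (Base P) (Dom (Base P) f) (Cod (Base P) f)"
      by (rule HomI)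
    show "Arr_map (along_quotient P ?G) f = Arr_map (fst m) f"
      by (simp add: along_quotient_simps(2)[OF f] Hom_Arr[OF ext_class_in_Hom[OF f]] rep[OF f])
  qed
  then have "along_quotient P ?G = fst m"
    by (cases "fst m") (simp add: along_quotient_def)
  then have eq: "(along_quotient P ?G, snd m) = m"
    by simp
  have n: "is_one_arrow (ext_collapse P) Z (?G, snd m)"
    using is_one_arrow_along_quotient_iff[OF G, of "snd m"] m by (simp only: eq)
  moreover have "comp_one_arrow P (?G, snd m) (collapse_arrow P) = m"
    using comp_one_arrow_collapse_arrow[OF n] eq by simp
  ultimately show ?thesis
    by blast
qed

text \<open>The quotient functor is the identity on objects and every arrow of the collapse is a class,
  so naturality and the inequalities say the same about a family of components on either side.\<close>

lemma is_two_arrow_along_quotient_iff: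
  assumes m: "is_one_arrow (ext_collapse P) Z m" and n: "is_one_arrow (ext_collapse P) Z n"
  shows "is_two_arrow P Z \<lparr>Src = comp_one_arrow P m (collapse_arrow P),
      Tgt = comp_one_arrow P n (collapse_arrow P), Cpt = \<theta>\<rparr> \<longleftrightarrow>
    is_two_arrow (ext_collapse P) Z \<lparr>Src = m, Tgt = n, Cpt = \<theta>\<rparr>"
  using m n is_one_arrow_comp_collapse_arrow[OF m] is_one_arrow_comp_collapse_arrow[OF n]
  unfolding is_two_arrow_def natural_transformation_def
  by (simp add: comp_one_arrow_collapse_arrow Hom_ext_category)

end

section \<open>Precomposition with the collapse\<close>

context elementary_doctrine
begin

lemma precomp_collapse_arrow_Obj:
  "is_one_arrow (ext_collapse P) Z n \<Longrightarrow>
    Obj_map (precomp P (collapse_arrow P) (ED_hom (ext_collapse P) Z)) n =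
      comp_one_arrow P n (collapse_arrow P)"
  by (simp add: precomp_def)

lemma precomp_collapse_arrow_Arr:
  assumes \<theta>: "is_two_arrow (ext_collapse P) Z \<theta>"
  shows "Arr_map (precomp P (collapse_arrow P) (ED_hom (ext_collapse P) Z)) \<theta> =
    \<lparr>Src = comp_one_arrow P (Src \<theta>) (collapse_arrow P),
     Tgt = comp_one_arrow P (Tgt \<theta>) (collapse_arrow P), Cpt = Cpt \<theta>\<rparr>"
proof -
  have "compose (Obj (Base P)) (Cpt \<theta>) (\<lambda>A \<in> Obj (Base P). A) = Cpt \<theta>"
    using two_arrow_extensional[OF \<theta>]
    by (intro extensionalityI[of _ "Obj (Base P)"]) (simp_all add: compose_eq)
  then show ?thesis
    using \<theta> by (simp add: precomp_def collapse_arrow_def)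
qed

lemma is_two_arrow_precomp:
  assumes \<theta>: "is_two_arrow (ext_collapse P) Z \<theta>"
  shows "is_two_arrow P Z (Arr_map (precomp P (collapse_arrow P) (ED_hom (ext_collapse P) Z)) \<theta>)"
  using \<theta> is_two_arrow_along_quotient_iff[OF two_arrow_Src[OF \<theta>] two_arrow_Tgt[OF \<theta>], of "Cpt \<theta>"]
  by (cases \<theta>) (simp add: precomp_collapse_arrow_Arr)

lemma is_functor_precomp:
  assumes Z: "elementary_doctrine Z"
  shows "is_functor (ED_hom (ext_collapse P) Z) (ED_hom P Z)
    (precomp P (collapse_arrow P) (ED_hom (ext_collapse P) Z))"
    (is "is_functor ?X ?D ?F")
proof -
  interpret Z: elementary_doctrine Z by fact
  note X = inf_semilattice_doctrine_ext_collapse and ZI = Z.inf_semilattice_doctrine_axioms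
  have obj: "Obj_map ?F \<in> Obj ?X \<rightarrow>\<^sub>E Obj ?D"
    by (auto simp: precomp_def is_one_arrow_comp_collapse_arrow)
  have arr: "Arr_map ?F \<in> Arr ?X \<rightarrow>\<^sub>E Arr ?D"
    using is_two_arrow_precomp by (fastforce simp: precomp_def)
  have hom: "Arr_map ?F \<theta> \<in> Hom ?D (Obj_map ?F m) (Obj_map ?F n)"
    if "\<theta> \<in> Hom ?X m n" for \<theta> m n
    using that is_two_arrow_precomp[of Z \<theta>] two_arrow_Src[of "ext_collapse P" Z \<theta>]
      two_arrow_Tgt[of "ext_collapse P" Z \<theta>]
    by (auto simp: Hom_ED_hom precomp_collapse_arrow_Arr precomp_collapse_arrow_Obj)
  have ide: "Arr_map ?F (Ide ?X m) = Ide ?D (Obj_map ?F m)" if "m \<in> Obj ?X" for m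
    using that is_two_arrow_Ide[OF X ZI, of m]
    by (simp add: precomp_collapse_arrow_Arr precomp_collapse_arrow_Obj comp_one_arrow_collapse_arrow)
  have comp: "Arr_map ?F (\<eta> \<cdot>\<^bsub>?X\<^esub> \<theta>) = Arr_map ?F \<eta> \<cdot>\<^bsub>?D\<^esub> Arr_map ?F \<theta>"
    if "\<theta> \<in> Hom ?X m n" "\<eta> \<in> Hom ?X n l" for \<theta> \<eta> m n l
    using that is_two_arrow_Comp[OF X ZI, of \<theta> \<eta>]
    by (simp add: Hom_ED_hom precomp_collapse_arrow_Arr)
  show ?thesis
    unfolding is_functor_def
    using category_ED_hom[OF X ZI] category_ED_hom[OF inf_semilattice_doctrine_axioms ZI]
      obj arr hom ide comp by blast
qed

lemma faithful_precomp:
  "faithful (ED_hom (ext_collapse P) Z) (precomp P (collapse_arrow P) (ED_hom (ext_collapse P) Z))"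
  unfolding faithful_def
proof (intro ballI inj_onI)
  fix m n \<theta> \<eta>
  assume "\<theta> \<in> Hom (ED_hom (ext_collapse P) Z) m n" "\<eta> \<in> Hom (ED_hom (ext_collapse P) Z) m n"
    and "Arr_map (precomp P (collapse_arrow P) (ED_hom (ext_collapse P) Z)) \<theta> =
      Arr_map (precomp P (collapse_arrow P) (ED_hom (ext_collapse P) Z)) \<eta>"
  then show "\<theta> = \<eta>"
    by (cases \<theta>, cases \<eta>) (simp add: Hom_ED_hom precomp_collapse_arrow_Arr)
qed

lemma full_precomp:
  "full (ED_hom (ext_collapse P) Z) (ED_hom P Z)
    (precomp P (collapse_arrow P) (ED_hom (ext_collapse P) Z))"
  unfolding full_def
proof (intro ballI)
  fix m n \<eta>
  let ?F = "precomp P (collapse_arrow P) (ED_hom (ext_collapse P) Z)"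
  assume mn: "m \<in> Obj (ED_hom (ext_collapse P) Z)" "n \<in> Obj (ED_hom (ext_collapse P) Z)"
    and \<eta>: "\<eta> \<in> Hom (ED_hom P Z) (Obj_map ?F m) (Obj_map ?F n)"
  let ?\<theta> = "\<lparr>Src = m, Tgt = n, Cpt = Cpt \<eta>\<rparr>"
  have \<eta>_eq: "\<lparr>Src = comp_one_arrow P m (collapse_arrow P),
      Tgt = comp_one_arrow P n (collapse_arrow P), Cpt = Cpt \<eta>\<rparr> = \<eta>"
    using mn \<eta> by (cases \<eta>) (simp add: Hom_ED_hom precomp_collapse_arrow_Obj)
  have \<theta>: "is_two_arrow (ext_collapse P) Z ?\<theta>"
    using is_two_arrow_along_quotient_iff[of Z m n "Cpt \<eta>"] mn \<eta> by (simp add: \<eta>_eq Hom_ED_hom)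
  then have "?\<theta> \<in> Hom (ED_hom (ext_collapse P) Z) m n" "Arr_map ?F ?\<theta> = \<eta>"
    using precomp_collapse_arrow_Arr[OF \<theta>] by (simp_all add: Hom_ED_hom \<eta>_eq)
  then show "\<exists>\<theta> \<in> Hom (ED_hom (ext_collapse P) Z) m n. Arr_map ?F \<theta> = \<eta>"
    by blast
qed

lemma essentially_surjective_precomp:
  assumes Z: "CED Z"
  shows "essentially_surjective (ED_hom (ext_collapse P) Z) (ED_hom P Z)
    (precomp P (collapse_arrow P) (ED_hom (ext_collapse P) Z))"
  unfolding essentially_surjective_def
proof
  fix m assume m: "m \<in> Obj (ED_hom P Z)"
  have "inf_semilattice_doctrine Z"
    using Z by (simp add: CED_def elementary_doctrine_def)
  then interpret D: category "ED_hom P Z"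
    by (rule category_ED_hom[OF inf_semilattice_doctrine_axioms])
  obtain n where "is_one_arrow (ext_collapse P) Z n" "comp_one_arrow P n (collapse_arrow P) = m"
    using one_arrow_factors_through_collapse[OF Z, of m] m unfolding ED_hom_simps by blast
  moreover have "isomorphic (ED_hom P Z) m m"
    unfolding isomorphic_def
    using D.Ide_in_Hom[OF m] D.Comp_Ide[OF D.Ide_in_Hom[OF m]] by blast
  ultimately show "\<exists>n \<in> Obj (ED_hom (ext_collapse P) Z). isomorphic (ED_hom P Z)
      (Obj_map (precomp P (collapse_arrow P) (ED_hom (ext_collapse P) Z)) n) m"
    by (intro bexI[of _ n]) (simp_all add: precomp_collapse_arrow_Obj)
qed

end

theorem theorem5p6:
  fixes P :: "('o, 'a, 'p) doctrine"
    and Z :: "('o2, 'a2, 'p2) doctrine"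
  assumes "elementary_doctrine P"
    and "CED Z"
  shows "CED (ext_collapse P) \<and>
    is_one_arrow P (ext_collapse P) (collapse_arrow P) \<and>
    essential_equivalence (CED_hom (ext_collapse P) Z) (ED_hom P Z)
      (precomp P (collapse_arrow P) (CED_hom (ext_collapse P) Z))"
proof -
  interpret elementary_doctrine P by fact
  have "elementary_doctrine Z"
    using assms(2) by (simp add: CED_def)
  then show ?thesis
    unfolding CED_hom_def essential_equivalence_def
    by (intro conjI CED_ext_collapse is_one_arrow_collapse_arrow is_functor_precomp full_precomp
        faithful_precomp essentially_surjective_precomp assms(2))
qed

end
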